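(* Let $d\ge1$, $\mu$ a partition of $d$, and let $M=\Phi(G)$ be the (standard form) Hurwitz mobile obtained from a marked genus-$0$ Hurwitz galaxy $G$ of type $(0,\mu,(1^d))$. Then $M$ is pruned (i.e. $G$ has no black face that is a bubble) if and only if each black polygon $P$ of $M$ satisfies one of the following two conditions: (1) the weight-$1$ edge incident to $P$ has label $y\neq 0$ and is interrupted by the next labelled edge $z$ of $M$ (the first edge reached in a counterclockwise path starting at $y$); (2) the weight-$1$ edge incident to $P$ has label $0$ and either (a) working counterclockwise from the edge $0$, the next labelled edge of $M$ is a weight-$0$ edge, or (b) the next labelled edge of $M$ (counterclockwise from the edge $0$) is a weight-$1$ edge of label $y$, and there exists an edge of label $z\neq0$ in $M$ that does not interrupt $y$.
   Context: Hurwitz galaxy of type $(0,\mu,(1^d))$, $b=\ell(\mu)+d-2$: a graph $G$ on the sphere dividing it into $\ell(\mu)+d$ open-disk faces coloured white and black, every edge adjacent to one white and one black face; white faces labelled $1,\dots,\ell(\mu)$, the white face $i$ having $\mu_i(b+1)$ boundary vertices (degree $\mu_i$); black faces labelled $1,\dots,d$, each with $b+1$ boundary vertices (degree $1$); vertices coloured $0,\dots,b$ cyclically clockwise around white faces; for each $i\in\{1,\dots,b\}$ there are $d-1$ vertices of colour $i$, $d-2$ of them $2$-valent and one $4$-valent; $d$ vertices of colour $0$, all $2$-valent. Edges are oriented from colour $c$ to colour $c+1\bmod(b+1)$. A face is a bubble if exactly one $4$-valent vertex lies on its boundary. A marked galaxy has a chosen colour-$0$ vertex $x_0$; $\delta(x)$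 is the length of a shortest oriented path from $x_0$ to $x$; an edge $e=u\to v$ has weight $w(e)=(\delta(u)+1-\delta(v))/(b+1)\in\mathbb{Z}_{\ge0}$, and is geodesic iff $w(e)=0$. Construction of $\Phi(G)$: (1) in each face of degree $i$ place an oriented $i$-gon (clockwise in white faces, counterclockwise in black faces); its nodes and arcs form the white/black polygons of $M$. (2) Join the $i$ nodes in a face $F$ of degree $i$ by auxiliary lines to the midpoints of the $i$ boundary edges of $F$ going from colour $b$ to colour $0$; this divides $F$ into the polygon interior and $i$ sub-regions, each containing a boundary path $0\to1\to\dots\to b$ and one arc of the polygon. (3) For each non-geodesic edge $e=u\to v$, with incident white face $F_\circ$ and black face $F_\bullet$, let $x$ (resp. $y$) be the origin of the unique arc of the polygon lying in the same sub-region of $F_\circ$ (resp. $F_\bullet$) as $v$; add an edge between $x$ and $y$ through $e$, with label $c(v)$ (the colour of $v$) and weight $w(e)$. (4) For each vertex $v$ with two incoming geodesic edges, with incident white faces $F_\circ,F'_\circ$, let $y,y'$ be the origins of the arcs of the respective polygons in the same sub-regions as $v$; add an edge through $v$ between $y$ and $y'$ with label $c(v)$ and weight $0$. (5) Remove the auxiliary lines. $M=\Phi(G)$ is a plane graph (a Hurwitz mobile in standard form); it is called pruned if $G$ has no black bubble. Each black polygon is incident to exactly one edge, of weight $1$. Distances and interruption: let $P$ be a black polygon of $M$, $y$ the weight-$1$ edge incident to $P$, and $z$ another labelled edge. The white distance $d_\circ(y,z)$ (resp. black distance $d_\bullet(y,z)$) is the number of white (resp. black) polygon arcs traversed by the counterclockwise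 path that starts at $y$, traverses the black arc of $P$, continues along $M$ and ends at $z$. The edge $y$ is interrupted by $z$ if $d_\circ(y,z)<d_\bullet(y,z)$, or $d_\circ(y,z)=d_\bullet(y,z)$ and (label of) $y<z$. Edges are identified with their labels.
   Formalization: The case d=1 is excluded (d≥2 is assumed): there G is a single loop without bubbles, so M is pruned, but its only labelled edge has label 0 and weight 1, so neither condition (1) nor (2) holds and the claim fails. *)

theory Defs
  imports Complex_Main "HOL-Combinatorics.Combinatorics"
begin

(* Graphs embedded in an oriented surface with open-disk faces, up to orientation-preserving
   homeomorphism, are encoded by rotation systems. Each edge consists of two darts, one starting
   at each of its ends and exchanged by opp; rot sends a dart to the next dart counterclockwise
   around its origin. Vertices, edges and faces are sets of darts: a vertex is the set of darts
   starting there, a face the set of darts having that face on their left. *)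

record 'a cmap =
  darts :: "'a set"
  rot :: "'a \<Rightarrow> 'a"
  opp :: "'a \<Rightarrow> 'a"

definition vertex_of :: "('a, 'b) cmap_scheme \<Rightarrow> 'a \<Rightarrow> 'a set" where
  "vertex_of M a = orbit (rot M) a"

definition vertices :: "('a, 'b) cmap_scheme \<Rightarrow> 'a set set" where
  "vertices M = vertex_of M ` darts M"

definition edge_of :: "('a, 'b) cmap_scheme \<Rightarrow> 'a \<Rightarrow> 'a set" where
  "edge_of M a = {a, opp M a}"

definition edges :: "('a, 'b) cmap_scheme \<Rightarrow> 'a set set" where
  "edges M = edge_of M ` darts M"

(* next dart along the boundary of the face on the left, resp. on the right *)
definition left_succ :: "('a, 'b) cmap_scheme \<Rightarrow> 'a \<Rightarrow> 'a" where
  "left_succ M a = inv (rot M) (opp M a)"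

definition right_succ :: "('a, 'b) cmap_scheme \<Rightarrow> 'a \<Rightarrow> 'a" where
  "right_succ M a = rot M (opp M a)"

definition face_of :: "('a, 'b) cmap_scheme \<Rightarrow> 'a \<Rightarrow> 'a set" where
  "face_of M a = orbit (left_succ M) a"

definition faces :: "('a, 'b) cmap_scheme \<Rightarrow> 'a set set" where
  "faces M = face_of M ` darts M"

definition sphere_map :: "('a, 'b) cmap_scheme \<Rightarrow> bool" where
  "sphere_map M \<longleftrightarrow>
     finite (darts M) \<and> darts M \<noteq> {} \<and>
     rot M permutes darts M \<and> opp M permutes darts M \<and>
     (\<forall>a\<in>darts M. opp M a \<noteq> a \<and> opp M (opp M a) = a) \<and>
     (\<forall>a\<in>darts M. \<forall>a'\<in>darts M.
        (a, a') \<in> ({(x, rot M x) | x. x \<in> darts M} \<union> {(x, opp M x) | x. x \<in> darts M})\<^sup>*) \<and>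
     int (card (vertices M)) - int (card (edges M)) + int (card (faces M)) = 2"

definition is_partition :: "nat list \<Rightarrow> nat \<Rightarrow> bool" where
  "is_partition \<mu> d \<longleftrightarrow> sorted_wrt (\<ge>) \<mu> \<and> 0 \<notin> set \<mu> \<and> sum_list \<mu> = d"


record 'a galaxy = "'a cmap" +
  white :: "'a set set"
  flabel :: "'a set \<Rightarrow> nat"
  colour :: "'a set \<Rightarrow> nat"

definition white_faces :: "('a, 'b) galaxy_scheme \<Rightarrow> 'a set set" where
  "white_faces G = faces G \<inter> white G"

definition black_faces :: "('a, 'b) galaxy_scheme \<Rightarrow> 'a set set" where
  "black_faces G = faces G - white G"

(* An oriented edge is represented by its forward dart. The orientation is clockwise around
   white faces, so the white face lies on the right. *)
definition arrows :: "('a, 'b) galaxy_scheme \<Rightarrow> 'a set" where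
  "arrows G = {a \<in> darts G. face_of G a \<in> black_faces G \<and> face_of G (opp G a) \<in> white_faces G}"

abbreviation tail :: "('a, 'b) galaxy_scheme \<Rightarrow> 'a \<Rightarrow> 'a set" where
  "tail G e \<equiv> vertex_of G e"

abbreviation head :: "('a, 'b) galaxy_scheme \<Rightarrow> 'a \<Rightarrow> 'a set" where
  "head G e \<equiv> vertex_of G (opp G e)"

(* The number of boundary vertices of a face, counted along its contour, is card F; the valency
   of a vertex v is card v. *)
definition hurwitz_galaxy :: "nat list \<Rightarrow> nat \<Rightarrow> ('a, 'b) galaxy_scheme \<Rightarrow> bool" where
  "hurwitz_galaxy \<mu> d G \<longleftrightarrow> (let b = length \<mu> + d - 2 in
     sphere_map G \<and>
     (\<forall>a\<in>darts G. (face_of G a \<in> white_faces G) \<noteq> (face_of G (opp G a) \<in> white_faces G)) \<and>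
     bij_betw (flabel G) (white_faces G) {1..length \<mu>} \<and>
     bij_betw (flabel G) (black_faces G) {1..d} \<and>
     (\<forall>F\<in>white_faces G. card F = \<mu> ! (flabel G F - 1) * (b + 1)) \<and>
     (\<forall>F\<in>black_faces G. card F = b + 1) \<and>
     (\<forall>v\<in>vertices G. colour G v \<le> b) \<and>
     (\<forall>e\<in>arrows G. colour G (head G e) = (colour G (tail G e) + 1) mod (b + 1)) \<and>
     (\<forall>i\<in>{1..b}.
        card {v\<in>vertices G. colour G v = i} = d - 1 \<and>
        card {v\<in>vertices G. colour G v = i \<and> card v = 2} = d - 2 \<and>
        card {v\<in>vertices G. colour G v = i \<and> card v = 4} = 1) \<and>
     card {v\<in>vertices G. colour G v = 0} = d \<and>
     (\<forall>v\<in>vertices G. colour G v = 0 \<longrightarrow> card v = 2))"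

(* v \<inter> F \<noteq> {} says that v lies on the boundary of F: the corners of v are its darts, each
   belonging to the face on its left. *)
definition bubble :: "('a, 'b) galaxy_scheme \<Rightarrow> 'a set \<Rightarrow> bool" where
  "bubble G F \<longleftrightarrow> card {v\<in>vertices G. card v = 4 \<and> v \<inter> F \<noteq> {}} = 1"

definition pruned :: "('a, 'b) galaxy_scheme \<Rightarrow> bool" where
  "pruned G \<longleftrightarrow> (\<forall>F\<in>black_faces G. \<not> bubble G F)"

definition delta :: "('a, 'b) galaxy_scheme \<Rightarrow> 'a set \<Rightarrow> 'a set \<Rightarrow> nat" where
  "delta G x0 x = (LEAST n. (x0, x) \<in> {(tail G e, head G e) | e. e \<in> arrows G} ^^ n)"

definition edge_weight :: "nat \<Rightarrow> ('a, 'b) galaxy_scheme \<Rightarrow> 'a set \<Rightarrow> 'a \<Rightarrow> rat" where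
  "edge_weight b G x0 e =
     (of_nat (delta G x0 (tail G e)) + 1 - of_nat (delta G x0 (head G e))) / of_nat (b + 1)"

definition geodesic :: "nat \<Rightarrow> ('a, 'b) galaxy_scheme \<Rightarrow> 'a set \<Rightarrow> 'a \<Rightarrow> bool" where
  "geodesic b G x0 e \<longleftrightarrow> edge_weight b G x0 e = 0"

definition geodesics_into :: "nat \<Rightarrow> ('a, 'b) galaxy_scheme \<Rightarrow> 'a set \<Rightarrow> 'a set \<Rightarrow> 'a set" where
  "geodesics_into b G x0 v = {e \<in> arrows G. head G e = v \<and> geodesic b G x0 e}"


datatype shade = White | Black

fun other_shade :: "shade \<Rightarrow> shade" where
  "other_shade White = Black"
| "other_shade Black = White"

fun succ_in_face :: "('a, 'b) galaxy_scheme \<Rightarrow> shade \<Rightarrow> 'a \<Rightarrow> 'a" where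
  "succ_in_face G White = right_succ G"
| "succ_in_face G Black = left_succ G"

(* The nodes of the white (resp. black) polygons correspond, via the auxiliary lines, to the
   arrows from colour b to colour 0. *)
definition closing :: "('a, 'b) galaxy_scheme \<Rightarrow> 'a set" where
  "closing G = {e \<in> arrows G. colour G (head G e) = 0}"

(* The sub-region containing the arc with origin n, for a closing arrow n, given as the list of
   arrows whose heads are the successive vertices of its boundary path 0, 1, ..., b. *)
definition region :: "nat \<Rightarrow> ('a, 'b) galaxy_scheme \<Rightarrow> shade \<Rightarrow> 'a \<Rightarrow> 'a list" where
  "region b G s n = map (\<lambda>i. (succ_in_face G s ^^ i) n) [0..<b + 1]"

definition prev_node :: "nat \<Rightarrow> ('a, 'b) galaxy_scheme \<Rightarrow> shade \<Rightarrow> 'a \<Rightarrow> 'a" where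
  "prev_node b G s n = inv (succ_in_face G s ^^ (b + 1)) n"

(* Arc s n is the polygon arc with origin n and ArcRev s n the same arc traversed backwards;
   Lab s e is the half, drawn in the face of shade s incident to the arrow e, of the labelled
   edge drawn through e (if e is not geodesic) or through the head of e (if e is geodesic). *)
datatype 'a mdart = Arc shade 'a | ArcRev shade 'a | Lab shade 'a

fun has_half :: "nat \<Rightarrow> ('a, 'b) galaxy_scheme \<Rightarrow> 'a set \<Rightarrow> shade \<Rightarrow> 'a \<Rightarrow> bool" where
  "has_half b G x0 White e \<longleftrightarrow>
     \<not> geodesic b G x0 e \<or> card (geodesics_into b G x0 (head G e)) = 2"
| "has_half b G x0 Black e \<longleftrightarrow> \<not> geodesic b G x0 e"

definition halves :: "nat \<Rightarrow> ('a, 'b) galaxy_scheme \<Rightarrow> 'a set \<Rightarrow> shade \<Rightarrow> 'a \<Rightarrow> 'a mdart list" where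
  "halves b G x0 s n = map (Lab s) (filter (has_half b G x0 s) (region b G s n))"

(* The darts at a polygon node in counterclockwise order. In a white face the path 0, ..., b is
   seen clockwise, so labels decrease; in a black face they increase. *)
fun around :: "nat \<Rightarrow> ('a, 'b) galaxy_scheme \<Rightarrow> 'a set \<Rightarrow> shade \<Rightarrow> 'a \<Rightarrow> 'a mdart list" where
  "around b G x0 White n =
     [Arc White n] @ rev (halves b G x0 White n) @ [ArcRev White (prev_node b G White n)]"
| "around b G x0 Black n =
     [ArcRev Black (prev_node b G Black n)] @ halves b G x0 Black n @ [Arc Black n]"

definition node_lists :: "nat \<Rightarrow> ('a, 'b) galaxy_scheme \<Rightarrow> 'a set \<Rightarrow> 'a mdart list set" where
  "node_lists b G x0 = {around b G x0 s n | s n. n \<in> closing G}"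

fun opp_half :: "nat \<Rightarrow> ('a, 'b) galaxy_scheme \<Rightarrow> 'a set \<Rightarrow> 'a mdart \<Rightarrow> 'a mdart" where
  "opp_half b G x0 (Arc s n) = ArcRev s n"
| "opp_half b G x0 (ArcRev s n) = Arc s n"
| "opp_half b G x0 (Lab s e) =
     (if geodesic b G x0 e
      then Lab s (THE e'. e' \<in> geodesics_into b G x0 (head G e) \<and> e' \<noteq> e)
      else Lab (other_shade s) e)"

record 'm mobile = "'m cmap" +
  arcs :: "shade \<Rightarrow> 'm set"
  elabel :: "'m set \<Rightarrow> nat"
  eweight :: "'m set \<Rightarrow> rat"

(* The two halves of a labelled edge determine the same label and weight; for an edge through a
   vertex with two incoming geodesic edges the weight is edge_weight = 0. *)
definition Phi :: "nat \<Rightarrow> ('a, 'b) galaxy_scheme \<Rightarrow> 'a set \<Rightarrow> 'a mdart mobile" where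
  "Phi b G x0 =
    (let D = (\<Union>l\<in>node_lists b G x0. set l) in
     \<lparr> darts = D,
       rot = (\<lambda>x. if x \<in> D then cycle_of_list (THE l. l \<in> node_lists b G x0 \<and> x \<in> set l) x else x),
       opp = (\<lambda>x. if x \<in> D then opp_half b G x0 x else x),
       arcs = (\<lambda>s. Arc s ` closing G),
       elabel = (\<lambda>y. THE c. \<exists>s e. Lab s e \<in> y \<and> c = colour G (head G e)),
       eweight = (\<lambda>y. THE w. \<exists>s e. Lab s e \<in> y \<and> w = edge_weight b G x0 e) \<rparr>)"


definition arc_darts :: "('m, 'b) mobile_scheme \<Rightarrow> shade \<Rightarrow> 'm set" where
  "arc_darts M s = arcs M s \<union> opp M ` arcs M s"

definition labelled_edges :: "('m, 'b) mobile_scheme \<Rightarrow> 'm set set" where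
  "labelled_edges M = edge_of M ` (darts M - arc_darts M White - arc_darts M Black)"

(* black arcs are oriented counterclockwise, with the interior of the polygon on the left *)
definition black_polygons :: "('m, 'b) mobile_scheme \<Rightarrow> 'm set set" where
  "black_polygons M = face_of M ` arcs M Black"

definition polygon_edge :: "('m, 'b) mobile_scheme \<Rightarrow> 'm set \<Rightarrow> 'm set" where
  "polygon_edge M P =
     (THE y. y \<in> labelled_edges M \<and> (\<exists>x\<in>y. \<exists>p\<in>P. x \<in> vertex_of M p) \<and> eweight M y = 1)"

(* For an edge y incident to a black polygon: the dart of y directed towards that polygon. *)
definition towards_black :: "('m, 'b) mobile_scheme \<Rightarrow> 'm set \<Rightarrow> 'm" where
  "towards_black M y = (THE a. a \<in> y \<and> (\<exists>p\<in>arcs M Black. opp M a \<in> vertex_of M p))"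

(* The counterclockwise path around M starting at y: it first follows y to its black polygon and
   then keeps M on its left and the outer face on its right; ccw_path M y k is its k-th dart. *)
definition ccw_path :: "('m, 'b) mobile_scheme \<Rightarrow> 'm set \<Rightarrow> nat \<Rightarrow> 'm" where
  "ccw_path M y k = (right_succ M ^^ k) (towards_black M y)"

definition hit_time :: "('m, 'b) mobile_scheme \<Rightarrow> 'm set \<Rightarrow> 'm set \<Rightarrow> nat" where
  "hit_time M y z = (LEAST k. ccw_path M y k \<in> z)"

definition arc_dist :: "('m, 'b) mobile_scheme \<Rightarrow> shade \<Rightarrow> 'm set \<Rightarrow> 'm set \<Rightarrow> nat" where
  "arc_dist M s y z = card {k. k < hit_time M y z \<and> ccw_path M y k \<in> arc_darts M s}"

(* only meaningful for labelled edges y \<noteq> z with y incident to a black polygon *)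
definition interrupted_by :: "('m, 'b) mobile_scheme \<Rightarrow> 'm set \<Rightarrow> 'm set \<Rightarrow> bool" where
  "interrupted_by M y z \<longleftrightarrow>
     arc_dist M White y z < arc_dist M Black y z \<or>
     (arc_dist M White y z = arc_dist M Black y z \<and> elabel M y < elabel M z)"

definition next_labelled :: "('m, 'b) mobile_scheme \<Rightarrow> 'm set \<Rightarrow> 'm set \<Rightarrow> bool" where
  "next_labelled M y z \<longleftrightarrow>
     z \<in> labelled_edges M \<and> z \<noteq> y \<and>
     (\<exists>k. ccw_path M y k \<in> z \<and> (\<forall>j<k. \<forall>u\<in>labelled_edges M. u \<noteq> y \<longrightarrow> ccw_path M y j \<notin> u))"

(* The case d = 1 is degenerate: G is a single loop, so there is no bubble, but the only labelled
   edge of Phi(G) has label 0 and weight 1, hence no next labelled edge exists. *)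

end

theory Submission
  imports Defs
begin

text \<open>
  Let \<open>\<delta>\<close> be the distance from \<open>x0\<close>. Exactly one arrow of each black face is not geodesic; it has
  weight 1 and crosses the labelled edge of the corresponding polygon. Along the contour of the
  mobile, \<open>\<delta>\<close> minus the colour changes only at polygon arcs, by \<open>+(b + 1)\<close> at a black and by
  \<open>-(b + 1)\<close> at a white one. Moreover the contour is a single closed curve, because the edges of \<open>G\<close>
  not crossed by the mobile form a tree. Hence an edge \<open>y\<close> of weight 1 is interrupted by \<open>z\<close> iff
  \<open>\<delta>\<close> is larger at the vertex of \<open>z\<close> than at the vertex of \<open>y\<close>.

  From \<open>y\<close> the contour walks backwards along the black face until that face has a 4-valent vertex,
  where the next labelled edge is met. If \<open>y \<noteq> 0\<close>, the vertex of \<open>y\<close> is 4-valent, and another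
  4-valent vertex of the face is an interruption. If \<open>y = 0\<close> and the face is a bubble with 4-valent
  vertex \<open>v\<close>, every path from \<open>x0\<close> runs along the face up to \<open>v\<close>, so the second arrow into \<open>v\<close> is not
  geodesic, and all other 4-valent vertices are farther from \<open>x0\<close> than \<open>v\<close>.
\<close>

section \<open>Orbits, cycles and permutations in general\<close>

lemma orbit_card_funpow:
  assumes "permutation f"
  shows "orbit f x = (\<lambda>i. (f ^^ i) x) ` {..<card (orbit f x)}"
    and "(f ^^ card (orbit f x)) x = x"
    and "inj_on (\<lambda>i. (f ^^ i) x) {..<card (orbit f x)}"
    and "0 < card (orbit f x)"
proof -
  have self: "x \<in> orbit f x"
    using assms by (rule permutation_self_in_orbit)
  let ?N = "funpow_dist1 f x x"
  have img: "orbit f x = (\<lambda>i. (f ^^ i) x) ` {..<?N}"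
    using orbit_conv_funpow_dist1[OF self] by (simp add: lessThan_atLeast0)
  have inj: "inj_on (\<lambda>i. (f ^^ i) x) {..<?N}"
    using inj_on_funpow_dist1[OF self] by (simp add: lessThan_atLeast0)
  have card: "card (orbit f x) = ?N"
    unfolding img card_image[OF inj] by simp
  show "orbit f x = (\<lambda>i. (f ^^ i) x) ` {..<card (orbit f x)}"
    using img card by metis
  show "(f ^^ card (orbit f x)) x = x"
    unfolding card using self by (rule funpow_dist1_prop)
  show "inj_on (\<lambda>i. (f ^^ i) x) {..<card (orbit f x)}"
    using inj card by metis
  show "0 < card (orbit f x)"
    unfolding card by simp
qed

lemma add_mod_inj:
  fixes i j k n :: nat
  assumes "i < n" "j < n" "(k + i) mod n = (k + j) mod n"
  shows "i = j"
proof -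
  have "(k + i) mod n = (k + j) mod n \<Longrightarrow> i \<le> j \<Longrightarrow> j < n \<Longrightarrow> i = j" for i j
    using mod_eq_dvd_iff_nat[of "k + i" "k + j" n] nat_dvd_not_less[of "j - i" n] by force
  from this[of i j] this[of j i] assms show ?thesis
    by (metis nat_le_linear)
qed

lemma cycle_of_list_next:
  assumes "distinct (xs @ x # y # ys)"
  shows "cycle_of_list (xs @ x # y # ys) x = y"
proof -
  let ?cs = "xs @ x # y # ys"
  \<comment> \<open>Applying the cycle to every entry rotates the list by one; the entries at
    position \<open>length xs\<close> are compared.\<close>
  have "map (cycle_of_list ?cs) ?cs = rotate1 ?cs"
    using cyclic_rotation[OF assms, of 1] by simp
  then have "map (cycle_of_list ?cs) ?cs ! length xs = rotate1 ?cs ! length xs"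
    by (rule arg_cong)
  then show ?thesis
    by (cases xs) (simp_all add: nth_append)
qed

lemma filter_unique:
  assumes "distinct xs" "k \<in> set xs" "P k" "\<And>y. y \<in> set xs \<Longrightarrow> P y \<Longrightarrow> y = k"
  shows "filter P xs = [k]"
proof -
  have "filter P xs = filter (\<lambda>y. y = k) xs"
    using assms(3,4) by (intro filter_cong) auto
  also have "filter (\<lambda>y. y = k) xs = [k]"
    using assms(1,2) by (induction xs) (auto simp: filter_empty_conv)
  finally show ?thesis .
qed

text \<open>Recovers from a dart of the mobile its shade and the closing arrow of its node. This
  shows that the node lists are disjoint, so the \<open>THE\<close> in the rotation of
  \<open>Phi\<close> is determined. A reversed arc starts at the end of its arc, hence the shift by
  \<open>b + 1\<close>.\<close>

fun node :: "nat \<Rightarrow> 'a galaxy \<Rightarrow> 'a mdart \<Rightarrow> shade \<times> 'a" where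
  "node b G (Arc s n) = (s, n)"
| "node b G (ArcRev s m) = (s, (succ_in_face G s ^^ (b + 1)) m)"
| "node b G (Lab s e) = (s, inv (succ_in_face G s ^^ colour G (head G e)) e)"

lemma permutes_if_inj:
  assumes "finite X" "f ` X \<subseteq> X" "inj_on f X" "\<And>x. x \<notin> X \<Longrightarrow> f x = x"
  shows "f permutes X"
  using assms by (intro bij_imp_permutes) (auto simp: bij_betw_def endo_inj_surj)

lemma card_less_Suc: "card {j. j < Suc k \<and> P j} = card {j. j < k \<and> P j} + of_bool (P k)"
proof -
  have "{j. j < Suc k \<and> P j} = (if P k then insert k else id) {j. j < k \<and> P j}"
    by (auto simp: less_Suc_eq)
  then show ?thesis by simp
qed

section \<open>Arrows and colours\<close>

locale marked_galaxy =
  fixes G :: "'a galaxy" and \<mu> :: "nat list" and d :: nat and x0 :: "'a set" and b :: nat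
  assumes d_ge_2: "2 \<le> d"
    and galaxy: "hurwitz_galaxy \<mu> d G"
    and x0_vertex: "x0 \<in> vertices G"
    and colour_x0: "colour G x0 = 0"
    and b_eq: "b = length \<mu> + d - 2"
begin

abbreviation "D \<equiv> darts G"
abbreviation "A \<equiv> arrows G"
abbreviation "r \<equiv> rot G"
abbreviation "t \<equiv> opp G"
abbreviation "L \<equiv> left_succ G"
abbreviation "R \<equiv> right_succ G"

text \<open>The inverse of \<open>R\<close>: the previous arrow along the white face.\<close>

definition p :: "'a \<Rightarrow> 'a" where "p e = t (inv r e)"

text \<open>\<open>q e\<close> is the other arrow entering the head of \<open>e\<close>, or \<open>e\<close> itself if the head is 2-valent.\<close>
definition q :: "'a \<Rightarrow> 'a" where "q e = t (inv r (inv r (t e)))"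

abbreviation "c \<equiv> \<lambda>e. colour G (head G e)"

lemma
  shows sphere: "sphere_map G"
    and xor_faces: "\<And>a. a \<in> D \<Longrightarrow> (face_of G a \<in> white_faces G) \<noteq> (face_of G (t a) \<in> white_faces G)"
    and black_labels: "bij_betw (flabel G) (black_faces G) {1..d}"
    and card_black: "\<And>F. F \<in> black_faces G \<Longrightarrow> card F = b + 1"
    and colour_le: "\<And>v. v \<in> vertices G \<Longrightarrow> colour G v \<le> b"
    and colour_step: "\<And>e. e \<in> A \<Longrightarrow> colour G (head G e) = (colour G (tail G e) + 1) mod (b + 1)"
    and count_all: "\<And>i. i \<in> {1..b} \<Longrightarrow> card {v\<in>vertices G. colour G v = i} = d - 1"
    and count_2: "\<And>i. i \<in> {1..b} \<Longrightarrow> card {v\<in>vertices G. colour G v = i \<and> card v = 2} = d - 2"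
    and count_4: "\<And>i. i \<in> {1..b} \<Longrightarrow> card {v\<in>vertices G. colour G v = i \<and> card v = 4} = 1"
    and card_colour_0: "\<And>v. v \<in> vertices G \<Longrightarrow> colour G v = 0 \<Longrightarrow> card v = 2"
  using galaxy unfolding hurwitz_galaxy_def Let_def b_eq by blast+

lemma
  shows finite_D: "finite D"
    and r_permutes: "r permutes D"
    and t_permutes: "t permutes D"
    and connected: "\<And>a a'. a \<in> D \<Longrightarrow> a' \<in> D \<Longrightarrow>
        (a, a') \<in> ({(x, r x) | x. x \<in> D} \<union> {(x, t x) | x. x \<in> D})\<^sup>*"
  using sphere unfolding sphere_map_def by blast+

lemma t_t [simp]: "t (t a) = a"
proof (cases "a \<in> D")
  case True
  then show ?thesis using sphere unfolding sphere_map_def by blast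
next
  case False
  then show ?thesis using t_permutes by (simp add: permutes_def)
qed

lemma r_inv [simp]: "r (inv r a) = a" "inv r (r a) = a"
  using permutes_inverses[OF r_permutes] by auto

lemma in_D [simp]: "r a \<in> D \<longleftrightarrow> a \<in> D" "t a \<in> D \<longleftrightarrow> a \<in> D" "inv r a \<in> D \<longleftrightarrow> a \<in> D"
  using permutes_in_image[OF r_permutes] permutes_in_image[OF t_permutes]
    permutes_in_image[OF permutes_inv[OF r_permutes]] by auto

lemma L_eq: "L a = inv r (t a)" and R_eq: "R a = r (t a)"
  by (simp_all add: left_succ_def right_succ_def)

lemma L_eq_iff [simp]: "L a = L a' \<longleftrightarrow> a = a'"
  by (metis L_eq r_inv(1) t_t)

lemma R_eq_iff [simp]: "R a = R a' \<longleftrightarrow> a = a'"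
  by (metis R_eq r_inv(2) t_t)

lemma inj_L: "inj L" and inj_R: "inj R"
  by (simp_all add: inj_def)

lemma R_p [simp]: "R (p e) = e" and p_R [simp]: "p (R e) = e"
  by (simp_all add: R_eq p_def)

lemma R_q [simp]: "R (q e) = L e"
  by (simp add: R_eq q_def L_eq)

lemma p_L [simp]: "p (L e) = q e"
  by (metis R_q p_R)

lemma L_t_r: "L (t (r a)) = a"
  by (simp add: L_eq)

lemma surj_L: "\<exists>f. e = L f"
  using L_t_r[of e] by metis

lemma permutation_r: "permutation r"
  using r_permutes finite_D by (auto simp: permutation_permutes)

lemma L_permutes: "L permutes D"
proof -
  have "L = inv r \<circ> t" by (auto simp: L_eq)
  with permutes_compose[OF t_permutes permutes_inv[OF r_permutes]] show ?thesis by simp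
qed

lemma permutation_L: "permutation L"
  using L_permutes finite_D by (auto simp: permutation_permutes)

lemma face_L [simp]: "face_of G (L a) = face_of G a"
  unfolding face_of_def using permutation_L by (rule permutation_orbit_step)

lemma vertex_r [simp]: "vertex_of G (r a) = vertex_of G a"
  unfolding vertex_of_def using permutation_r by (rule permutation_orbit_step)

lemma vertex_inv_r [simp]: "vertex_of G (inv r a) = vertex_of G a"
  by (metis vertex_r r_inv(1))

lemma vertex_in: "a \<in> D \<Longrightarrow> vertex_of G a \<in> vertices G"
  by (simp add: vertices_def)

lemma arrow_iff: "e \<in> A \<longleftrightarrow> e \<in> D \<and> face_of G e \<notin> white_faces G"
  using xor_faces[of e] unfolding arrows_def black_faces_def white_faces_def faces_def by auto

lemma arrow_t: "a \<in> D \<Longrightarrow> t a \<in> A \<longleftrightarrow> a \<notin> A"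
  using xor_faces[of a] by (auto simp: arrow_iff)

text \<open>The darts \<open>a\<close> and \<open>t (r a)\<close> lie on the same face, so outgoing
  and incoming arrows alternate around a vertex.\<close>

lemma arrow_r: "a \<in> D \<Longrightarrow> r a \<in> A \<longleftrightarrow> a \<notin> A"
proof -
  assume a: "a \<in> D"
  have "t (r a) \<in> A \<longleftrightarrow> a \<in> A"
    using face_L[of "t (r a)"] a by (simp add: L_t_r arrow_iff)
  with arrow_t[of "r a"] a show ?thesis by simp
qed

lemma A_D: "e \<in> A \<Longrightarrow> e \<in> D"
  by (simp add: arrow_iff)

lemma finite_A: "finite A"
  using finite_D A_D by (meson finite_subset subsetI)

lemma L_A [simp]: "L e \<in> A \<longleftrightarrow> e \<in> A"
  by (simp add: arrow_iff) (simp add: L_eq)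

lemma R_A [simp]: "R e \<in> A \<longleftrightarrow> e \<in> A"
proof (cases "e \<in> D")
  case True
  then show ?thesis using arrow_r[of "t e"] arrow_t[of e] by (simp add: R_eq)
qed (auto simp: R_eq dest: A_D)

lemma p_A [simp]: "p e \<in> A \<longleftrightarrow> e \<in> A"
  by (metis R_A R_p)

lemma q_A [simp]: "q e \<in> A \<longleftrightarrow> e \<in> A"
  by (metis R_A R_q L_A)

lemma tail_L [simp]: "tail G (L e) = head G e" and tail_R [simp]: "tail G (R e) = head G e"
  by (simp_all add: L_eq R_eq)

lemma head_q [simp]: "head G (q e) = head G e"
  by (simp add: q_def)

lemma head_p [simp]: "head G (p e) = tail G e"
  by (simp add: p_def)

lemma head_in: "e \<in> A \<Longrightarrow> head G e \<in> vertices G"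
  using A_D vertex_in by simp

lemma tail_in: "e \<in> A \<Longrightarrow> tail G e \<in> vertices G"
  using A_D vertex_in by simp

lemma c_le: "e \<in> A \<Longrightarrow> c e \<le> b"
  using colour_le head_in by simp

lemma c_L: "e \<in> A \<Longrightarrow> c (L e) = (c e + 1) mod (b + 1)"
  using colour_step[of "L e"] by simp

lemma c_R: "e \<in> A \<Longrightarrow> c (R e) = (c e + 1) mod (b + 1)"
  using colour_step[of "R e"] by simp

lemma finite_vertices: "finite (vertices G)"
  using finite_D by (simp add: vertices_def)

text \<open>For a colour \<open>i\<close> at least 1, the \<open>d - 2\<close> two-valent vertices
  and the one four-valent vertex already exhaust the \<open>d - 1\<close> vertices of that colour;
  \<open>d_ge_2\<close> makes the truncated subtractions exact.\<close>

lemma valency: "v \<in> vertices G \<Longrightarrow> card v = 2 \<or> card v = 4"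
proof (cases "colour G v = 0")
  case True
  moreover assume "v \<in> vertices G"
  ultimately show ?thesis using card_colour_0 by simp
next
  case False
  assume v: "v \<in> vertices G"
  define i where "i = colour G v"
  have i: "i \<in> {1..b}" using False v colour_le by (simp add: i_def Suc_leI)
  let ?V = "{v\<in>vertices G. colour G v = i}"
  let ?V2 = "{v\<in>vertices G. colour G v = i \<and> card v = 2}"
  let ?V4 = "{v\<in>vertices G. colour G v = i \<and> card v = 4}"
  have fin: "finite ?V" "finite ?V2" "finite ?V4" using finite_vertices by auto
  have "card (?V2 \<union> ?V4) = card ?V2 + card ?V4"
    using fin by (intro card_Un_disjoint) auto
  also have "\<dots> = card ?V"
    using count_all[OF i] count_2[OF i] count_4[OF i] d_ge_2 by simp
  finally have "?V2 \<union> ?V4 = ?V"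
    using fin by (intro card_subset_eq) auto
  with v show ?thesis unfolding i_def by blast
qed

lemma t_eq_iff [simp]: "t a = t a' \<longleftrightarrow> a = a'"
  by (metis t_t)

text \<open>With valency 2 or 4, four rotations fix \<open>t e\<close>, so turning twice in either
  direction gives the same dart. By alternation, \<open>t e\<close> and the dart opposite to it are
  the only ones coming from arrows into the head.\<close>

lemma
  assumes e: "e \<in> A"
  shows into_head: "f \<in> A \<Longrightarrow> head G f = head G e \<Longrightarrow> f = e \<or> f = q e"
    and four_iff: "card (head G e) = 4 \<longleftrightarrow> q e \<noteq> e"
    and q_q: "q (q e) = e"
proof -
  define x where "x = t e"
  define m where "m = card (orbit r x)"
  have xD: "x \<in> D" and xA: "x \<notin> A"
    using e A_D arrow_t[of e] by (auto simp: x_def)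
  have m: "m = 2 \<or> m = 4"
    using valency[OF head_in[OF e]] by (simp add: m_def x_def vertex_of_def)
  note orb = orbit_card_funpow[OF permutation_r, of x, folded m_def]
  have eq4: "r (r (r (r x))) = x"
    using m orb(2) by (auto simp: eval_nat_numeral)
  then have rr: "inv r (inv r x) = r (r x)"
    by (metis r_inv(2))
  have q: "q e = t (r (r x))"
    by (metis q_def rr x_def)
  show "q (q e) = e"
    unfolding q_def[of "q e"] unfolding q by (simp add: x_def)
  have "m = 4 \<longleftrightarrow> r (r x) \<noteq> x"
  proof
    assume "m = 4"
    then show "r (r x) \<noteq> x"
      using inj_onD[OF orb(3), of 2 0] by (auto simp: eval_nat_numeral)
  next
    assume "r (r x) \<noteq> x"
    then show "m = 4" using m orb(2) by (auto simp: eval_nat_numeral)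
  qed
  then show "card (head G e) = 4 \<longleftrightarrow> q e \<noteq> e"
    unfolding q m_def vertex_of_def x_def by (metis t_t)
  assume f: "f \<in> A" and hf: "head G f = head G e"
  have "t f \<in> orbit r x"
    using hf permutation_self_in_orbit[OF permutation_r, of "t f"] by (simp add: vertex_of_def x_def)
  then obtain i where i: "i < m" "t f = (r ^^ i) x"
    using orb(1) by auto
  have "i < 4" using i m by auto
  then have "i = 0 \<or> i = 1 \<or> i = 2 \<or> i = 3" by auto
  moreover have "t f \<notin> A" using f arrow_t A_D by blast
  ultimately have "t f = x \<or> t f = r (r x)"
    using i xA xD by (auto simp: arrow_r eval_nat_numeral)
  then show "f = e \<or> f = q e"
    unfolding q x_def by (metis t_t)
qed

lemma L_q: "e \<in> A \<Longrightarrow> L (q e) = R e"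
  by (metis R_q q_q)

lemma out_of_head:
  assumes "e \<in> A" "g \<in> A" "tail G g = head G e"
  shows "g = L e \<or> g = R e"
proof -
  obtain f where f: "g = L f" using surj_L by blast
  then show ?thesis
    using into_head[of e f] assms L_q by auto
qed

text \<open>Colour 0 has no four-valent vertex and every other colour has exactly one, so both
  arrows enter the same vertex.\<close>

lemma same_four_colour:
  assumes "e \<in> A" "f \<in> A" "q e \<noteq> e" "q f \<noteq> f" "c e = c f"
  shows "f = e \<or> f = q e"
proof -
  define i where "i = c e"
  have "i \<noteq> 0"
  proof
    assume "i = 0"
    then have "card (head G e) = 2"
      using card_colour_0 head_in assms(1) by (simp add: i_def)
    then show False using four_iff[OF assms(1)] assms(3) by simp
  qed
  then have "i \<in> {1..b}" using c_le assms by (simp add: i_def Suc_leI)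
  from count_4[OF this] obtain w where w: "{v\<in>vertices G. colour G v = i \<and> card v = 4} = {w}"
    by (auto simp: card_1_singleton_iff)
  have "head G e \<in> {w}" "head G f \<in> {w}"
    unfolding w[symmetric] using assms head_in four_iff by (simp_all add: i_def)
  then show ?thesis using into_head assms by simp
qed

lemma q_eq_of_c_0: "e \<in> A \<Longrightarrow> c e = 0 \<Longrightarrow> q e = e"
  using card_colour_0[OF head_in, of e] four_iff[of e] by auto

lemma
  assumes e: "e \<in> A"
  shows L_period: "(L ^^ (b + 1)) e = e"
    and face_eq: "face_of G e = (\<lambda>i. (L ^^ i) e) ` {..<b + 1}"
proof -
  have "face_of G e \<in> black_faces G"
    using e by (simp add: arrows_def)
  then have "card (orbit L e) = b + 1"
    using card_black by (simp add: face_of_def)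
  then show "(L ^^ (b + 1)) e = e" "face_of G e = (\<lambda>i. (L ^^ i) e) ` {..<b + 1}"
    using orbit_card_funpow(1,2)[OF permutation_L, of e] by (simp_all add: face_of_def)
qed

lemma L_pow_A [simp]: "(L ^^ i) e \<in> A \<longleftrightarrow> e \<in> A"
  by (induction i) auto

lemma R_pow_A [simp]: "(R ^^ i) e \<in> A \<longleftrightarrow> e \<in> A"
  by (induction i) auto

lemma p_pow_A [simp]: "(p ^^ i) e \<in> A \<longleftrightarrow> e \<in> A"
  by (induction i) auto

lemma c_L_pow: "e \<in> A \<Longrightarrow> c ((L ^^ i) e) = (c e + i) mod (b + 1)"
proof (induction i)
  case 0
  then show ?case using c_le[of e] by simp
next
  case (Suc i)
  then show ?case using c_L[of "(L ^^ i) e"] by (simp add: mod_simps)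
qed

lemma c_R_pow: "e \<in> A \<Longrightarrow> c ((R ^^ i) e) = (c e + i) mod (b + 1)"
proof (induction i)
  case 0
  then show ?case using c_le[of e] by simp
next
  case (Suc i)
  then show ?case using c_R[of "(R ^^ i) e"] by (simp add: mod_simps)
qed

lemma c_L_pow_inj:
  assumes "e \<in> A" "i < b + 1" "j < b + 1" "c ((L ^^ i) e) = c ((L ^^ j) e)"
  shows "i = j"
  using assms c_L_pow add_mod_inj[of i "b + 1" j "c e"] by simp

section \<open>Distances and weights\<close>

definition steps :: "('a set \<times> 'a set) set" where
  "steps = {(tail G e, head G e) | e. e \<in> A}"

abbreviation "dist_to \<equiv> delta G x0"
abbreviation "dh \<equiv> \<lambda>e. delta G x0 (head G e)"
abbreviation "dt \<equiv> \<lambda>e. delta G x0 (tail G e)"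

text \<open>A version of \<open>geodesic\<close> in natural numbers, free of rational weights;
  \<open>geodesic_iff\<close> shows the equivalence.\<close>

definition geo :: "'a \<Rightarrow> bool" where "geo e \<longleftrightarrow> dh e = dt e + 1"

lemma steps_along_face:
  assumes "e \<in> A"
  shows "(head G e, head G ((L ^^ i) e)) \<in> steps\<^sup>*"
proof (induction i)
  case (Suc i)
  have "(head G ((L ^^ i) e), head G ((L ^^ Suc i) e)) \<in> steps"
    unfolding steps_def using assms by (auto intro!: exI[of _ "L ((L ^^ i) e)"])
  with Suc show ?case by simp
qed simp

text \<open>An arrow is undone by walking around the remaining \<open>b\<close> arrows of its black
  face.\<close>

lemma steps_reverse:
  assumes "e \<in> A"
  shows "(head G e, tail G e) \<in> steps\<^sup>*"
proof -
  have "head G ((L ^^ b) e) = tail G (L ((L ^^ b) e))" by simp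
  also have "\<dots> = tail G e" using L_period[OF assms] by simp
  finally show ?thesis using steps_along_face[OF assms, of b] by simp
qed

text \<open>Undirected connectivity suffices: \<open>r\<close> stays at a vertex, while
  \<open>t\<close> either follows an arrow or reverses one, which \<open>steps_reverse\<close> turns
  into an oriented path.\<close>

lemma reachable_vertex:
  assumes "v \<in> vertices G"
  shows "(x0, v) \<in> steps\<^sup>*"
proof -
  obtain a0 a where a: "x0 = vertex_of G a0" "a0 \<in> D" "v = vertex_of G a" "a \<in> D"
    using x0_vertex assms by (auto simp: vertices_def)
  from connected[OF a(2,4)] have "(vertex_of G a0, vertex_of G a) \<in> steps\<^sup>*"
  proof induction
    case (step y z)
    from step.hyps(2) have "y \<in> D" and z: "z = r y \<or> z = t y" by auto
    have "(vertex_of G y, vertex_of G z) \<in> steps\<^sup>*"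
    proof (cases "z = r y")
      case False
      with z have z: "z = t y" by simp
      show ?thesis
      proof (cases "y \<in> A")
        case True
        then show ?thesis unfolding z steps_def by blast
      next
        case False
        then have "t y \<in> A" using \<open>y \<in> D\<close> arrow_t by simp
        from steps_reverse[OF this] show ?thesis by (simp add: z)
      qed
    qed simp
    with step.IH show ?case by (rule rtrancl_trans)
  qed simp
  then show ?thesis by (simp add: a)
qed

lemma steps_colour:
  "(x0, v) \<in> steps ^^ n \<Longrightarrow> v \<in> vertices G \<and> colour G v = n mod (b + 1)"
proof (induction n arbitrary: v)
  case 0
  then show ?case using x0_vertex colour_x0 by simp
next
  case (Suc n)
  then obtain u where u: "(x0, u) \<in> steps ^^ n" "(u, v) \<in> steps" by auto
  then obtain e where e: "e \<in> A" "u = tail G e" "v = head G e"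
    by (auto simp: steps_def)
  have "colour G (tail G e) = n mod (b + 1)"
    using Suc.IH[OF u(1)] e by simp
  then show ?case
    unfolding e(3) using colour_step[OF e(1)] head_in[OF e(1)] by (simp add: mod_simps)
qed

lemma dist_path: "v \<in> vertices G \<Longrightarrow> (x0, v) \<in> steps ^^ dist_to v"
  using LeastI_ex[of "\<lambda>n. (x0, v) \<in> steps ^^ n"] reachable_vertex[of v]
  unfolding delta_def steps_def[symmetric] by (auto dest: rtrancl_imp_relpow)

lemma dist_least: "(x0, v) \<in> steps ^^ n \<Longrightarrow> dist_to v \<le> n"
  unfolding delta_def steps_def[symmetric] by (rule Least_le)

lemma colour_dist: "v \<in> vertices G \<Longrightarrow> colour G v = dist_to v mod (b + 1)"
  using steps_colour[OF dist_path] by simp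

lemma dist_0_iff: "v \<in> vertices G \<Longrightarrow> dist_to v = 0 \<longleftrightarrow> v = x0"
  using dist_path[of v] dist_least[of x0 0] by (cases "dist_to v = 0") auto

lemma dh_le:
  assumes "e \<in> A"
  shows "dh e \<le> dt e + 1"
proof -
  have "(x0, head G e) \<in> steps ^^ Suc (dt e)"
    using dist_path[OF tail_in[OF assms]] assms by (auto simp: steps_def)
  from dist_least[OF this] show ?thesis by simp
qed

text \<open>The last arrow of a shortest path from \<open>x0\<close> is geodesic.\<close>

lemma ex_geo_into:
  assumes v: "v \<in> vertices G" "v \<noteq> x0"
  shows "\<exists>e. e \<in> A \<and> head G e = v \<and> geo e"
proof -
  obtain n where n: "dist_to v = Suc n"
    using dist_0_iff[OF v(1)] v(2) by (cases "dist_to v") auto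
  with dist_path[OF v(1)] obtain u where u: "(x0, u) \<in> steps ^^ n" "(u, v) \<in> steps" by auto
  then obtain e where e: "e \<in> A" "u = tail G e" "v = head G e"
    by (auto simp: steps_def)
  have "dt e \<le> n" using dist_least[OF u(1)] e by simp
  moreover have "dh e = Suc n" using n e by simp
  ultimately have "geo e" using dh_le[OF e(1)] by (simp add: geo_def)
  with e show ?thesis by blast
qed

lemma ex_arrow_into: "v \<in> vertices G \<Longrightarrow> \<exists>e. e \<in> A \<and> head G e = v"
proof -
  assume "v \<in> vertices G"
  then obtain a where a: "a \<in> D" "v = vertex_of G a" by (auto simp: vertices_def)
  show ?thesis
  proof (cases "a \<in> A")
    case True
    obtain f where "a = L f" using surj_L by blast
    then show ?thesis using a True by auto
  next
    case False
    then show ?thesis using a arrow_t[of a] by (intro exI[of _ "t a"]) simp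
  qed
qed

text \<open>The weight as a natural number. Neither the truncated subtraction nor the division loses
  anything on arrows, by \<open>dh_le\<close> and \<open>dt_eq\<close>.\<close>

definition wt :: "'a \<Rightarrow> nat" where "wt e = (dt e + 1 - dh e) div (b + 1)"

text \<open>Colours are distances modulo \<open>b + 1\<close> and grow by one along an arrow, so the
  defect \<open>dt e + 1 - dh e\<close> is a multiple of \<open>b + 1\<close>.\<close>

lemma dt_eq: "e \<in> A \<Longrightarrow> dt e + 1 = dh e + (b + 1) * wt e"
proof -
  assume e: "e \<in> A"
  have "(dt e + 1) mod (b + 1) = dh e mod (b + 1)"
    using colour_step[OF e] colour_dist[OF head_in[OF e]] colour_dist[OF tail_in[OF e]]
    by (simp add: mod_simps)
  then have "b + 1 dvd dt e + 1 - dh e"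
    using mod_eq_dvd_iff_nat[OF dh_le[OF e]] by blast
  then show ?thesis
    unfolding wt_def using dh_le[OF e] by (metis dvd_mult_div_cancel le_add_diff_inverse)
qed

lemma geo_iff_wt: "e \<in> A \<Longrightarrow> geo e \<longleftrightarrow> wt e = 0"
  using dt_eq[of e] by (auto simp: geo_def)

text \<open>Distances telescope around the face, so the defects of its \<open>b + 1\<close> arrows
  add up to \<open>b + 1\<close>.\<close>

lemma sum_wt_face:
  assumes e: "e \<in> A"
  shows "(\<Sum>i<b + 1. wt ((L ^^ i) e)) = 1"
proof -
  let ?f = "\<lambda>i. dt ((L ^^ i) e)"
  have "(\<Sum>i<b + 1. ?f i + 1) = (\<Sum>i<b + 1. ?f (Suc i) + (b + 1) * wt ((L ^^ i) e))"
    using dt_eq e by (intro sum.cong) auto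
  then have "(\<Sum>i<b + 1. ?f i) + (b + 1) = (\<Sum>i<b + 1. ?f (Suc i)) + (b + 1) * (\<Sum>i<b + 1. wt ((L ^^ i) e))"
    by (simp only: sum.distrib sum_distrib_left) simp
  moreover have "(\<Sum>i<b + 1. ?f (Suc i)) + ?f 0 = (\<Sum>i<b + 1. ?f i) + ?f (b + 1)"
    using sum.lessThan_Suc_shift[of ?f "b + 1"] sum.lessThan_Suc[of ?f "b + 1"] by linarith
  moreover have "?f (b + 1) = ?f 0"
    using L_period[OF e] by simp
  ultimately have "b + 1 = (b + 1) * (\<Sum>i<b + 1. wt ((L ^^ i) e))"
    by linarith
  then have "(b + 1) * (\<Sum>i<b + 1. wt ((L ^^ i) e)) = (b + 1) * 1"
    unfolding mult_1_right by (rule sym)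
  then show ?thesis unfolding mult_cancel1 by simp
qed

lemma face_nongeo:
  assumes e: "e \<in> A"
  obtains i where "i < b + 1" "\<not> geo ((L ^^ i) e)" "dt ((L ^^ i) e) = dh ((L ^^ i) e) + b"
    "\<And>j. j < b + 1 \<Longrightarrow> \<not> geo ((L ^^ j) e) \<Longrightarrow> j = i"
proof -
  from sum_wt_face[OF e] obtain i where i: "i < b + 1" "wt ((L ^^ i) e) = 1"
    "\<And>j. j < b + 1 \<Longrightarrow> i \<noteq> j \<Longrightarrow> wt ((L ^^ j) e) = 0"
    unfolding One_nat_def by (subst (asm) sum_eq_Suc0_iff) auto
  have "\<not> geo ((L ^^ i) e)" using i(2) geo_iff_wt e by simp
  moreover have "dt ((L ^^ i) e) = dh ((L ^^ i) e) + b" using dt_eq[of "(L ^^ i) e"] i(2) e by simp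
  ultimately show ?thesis using that[of i] i(1,3) geo_iff_wt e
    by (metis L_pow_A)
qed

section \<open>The non-geodesic arrow of a black face\<close>

definition ng :: "'a \<Rightarrow> 'a" where
  "ng e = (THE f. f \<in> face_of G e \<and> \<not> geo f)"

lemma
  assumes e: "e \<in> A"
  shows ng_face: "ng e \<in> face_of G e"
    and ng_nongeo: "\<not> geo (ng e)"
    and ng_unique: "f \<in> face_of G e \<Longrightarrow> \<not> geo f \<Longrightarrow> f = ng e"
    and dt_ng: "dt (ng e) = dh (ng e) + b"
proof -
  from face_nongeo[OF e] obtain i where i: "i < b + 1" "\<not> geo ((L ^^ i) e)"
    "dt ((L ^^ i) e) = dh ((L ^^ i) e) + b"
    "\<And>j. j < b + 1 \<Longrightarrow> \<not> geo ((L ^^ j) e) \<Longrightarrow> j = i" by metis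
  have i_face: "(L ^^ i) e \<in> face_of G e"
    unfolding face_eq[OF e] using i(1) by blast
  have i_unique: "f = (L ^^ i) e" if "f \<in> face_of G e" "\<not> geo f" for f
    using that i(4) unfolding face_eq[OF e] by blast
  have "ng e = (L ^^ i) e"
    unfolding ng_def
  proof (rule the_equality)
    show "(L ^^ i) e \<in> face_of G e \<and> \<not> geo ((L ^^ i) e)" using i_face i(2) ..
  qed (use i_unique in blast)
  note eq = this
  show "ng e \<in> face_of G e" unfolding eq by (fact i_face)
  show "\<not> geo (ng e)" unfolding eq by (fact i(2))
  show "dt (ng e) = dh (ng e) + b" unfolding eq by (fact i(3))
  show "f \<in> face_of G e \<Longrightarrow> \<not> geo f \<Longrightarrow> f = ng e" unfolding eq by (fact i_unique)
qed

lemma face_self: "e \<in> face_of G e"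
  unfolding face_of_def using permutation_self_in_orbit[OF permutation_L] .

lemma in_face:
  assumes "e \<in> A"
  shows "f \<in> face_of G e \<longleftrightarrow> (\<exists>i<b + 1. f = (L ^^ i) e)"
  unfolding face_eq[OF assms] by blast

lemma face_A:
  assumes "e \<in> A" "f \<in> face_of G e"
  shows "f \<in> A"
proof -
  obtain i where "f = (L ^^ i) e" using assms(2) unfolding in_face[OF assms(1)] by blast
  then show ?thesis using assms(1) by simp
qed

lemma face_L_pow [simp]: "face_of G ((L ^^ i) e) = face_of G e"
  by (induction i) simp_all

lemma face_face:
  assumes "e \<in> A" "f \<in> face_of G e"
  shows "face_of G f = face_of G e"
proof -
  obtain i where "f = (L ^^ i) e" using assms(2) unfolding in_face[OF assms(1)] by blast
  then show ?thesis by simp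
qed

lemma ng_self: "e \<in> A \<Longrightarrow> \<not> geo e \<Longrightarrow> ng e = e"
  using ng_unique[OF _ face_self] by simp

lemma ng_A [simp]: "e \<in> A \<Longrightarrow> ng e \<in> A"
  using ng_face face_A by blast

lemma ng_L [simp]: "ng (L e) = ng e"
  by (simp add: ng_def)

lemma dt_nongeo: "e \<in> A \<Longrightarrow> \<not> geo e \<Longrightarrow> dt e = dh e + b"
  using dt_ng[of e] ng_self[of e] by simp

text \<open>Every vertex other than \<open>x0\<close> is entered by some geodesic arrow; if
  \<open>e\<close> is not geodesic, that arrow must be \<open>q e\<close> and differ from
  \<open>e\<close>.\<close>

lemma nongeo_head:
  assumes e: "e \<in> A" "\<not> geo e"
  shows "head G e = x0 \<and> q e = e \<or> head G e \<noteq> x0 \<and> q e \<noteq> e \<and> geo (q e)"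
proof (cases "head G e = x0")
  case True
  then show ?thesis using q_eq_of_c_0[OF e(1)] colour_x0 by simp
next
  case False
  then obtain f where "f \<in> A" "head G f = head G e" "geo f"
    using ex_geo_into[OF head_in[OF e(1)]] by blast
  then have "f = q e" using into_head e by blast
  with \<open>geo f\<close> e False show ?thesis by metis
qed

lemma c_0_nongeo_iff: "e \<in> A \<Longrightarrow> \<not> geo e \<Longrightarrow> c e = 0 \<longleftrightarrow> head G e = x0"
  using nongeo_head[of e] q_eq_of_c_0[of e] colour_x0 by auto

text \<open>If all vertices of a black face were two-valent, the face together with its opposite
  darts would be closed under \<open>r\<close> and \<open>t\<close>. By connectivity it would be the
  whole map, leaving one black face although \<open>d\<close> is at least 2.\<close>

lemma face_has_four:
  assumes e: "e \<in> A"
  shows "\<exists>f\<in>face_of G e. q f \<noteq> f"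
proof (rule ccontr)
  assume no: "\<not> ?thesis"
  define S where "S = face_of G e \<union> t ` face_of G e"
  have L_face: "L f \<in> face_of G e" if "f \<in> face_of G e" for f
    using that face_self[of "L f"] face_face[OF e that] by simp
  have closed: "r a \<in> S \<and> t a \<in> S" if a: "a \<in> S" for a
  proof (cases "a \<in> face_of G e")
    case True
    have "a \<in> A" using face_A[OF e True] .
    have "(L ^^ b) a \<in> face_of G a" unfolding in_face[OF \<open>a \<in> A\<close>] by auto
    then have "(L ^^ b) a \<in> face_of G e" using face_face[OF e True] by simp
    \<comment> \<open>The dart \<open>(L ^^ b) a\<close> precedes \<open>a\<close> on its face,
      since \<open>L\<close> has period \<open>b + 1\<close> there.\<close>
    moreover have "r a = t ((L ^^ b) a)"
      using L_period[OF \<open>a \<in> A\<close>] by (simp add: L_eq) (metis r_inv(1) t_t)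
    ultimately show ?thesis using True by (auto simp: S_def)
  next
    case False
    then obtain f where f: "f \<in> face_of G e" "a = t f" using a by (auto simp: S_def)
    have "f \<in> A" using face_A[OF e f(1)] .
    moreover have "q f = f" using no f by blast
    ultimately have "r a = L f" using L_q[of f] by (simp add: f(2) R_eq)
    then show ?thesis using f L_face by (auto simp: S_def)
  qed
  have "e \<in> S" using face_self by (simp add: S_def)
  have "a \<in> S" if "a \<in> D" for a
    using connected[OF A_D[OF e] that]
  proof induction
    case base
    then show ?case by fact
  next
    case (step y z)
    then show ?case using closed by auto
  qed
  then have "a \<in> face_of G e" if "a \<in> A" for a
    using that face_A[OF e] arrow_t A_D unfolding S_def by blast
  then have "F = face_of G e" if F: "F \<in> black_faces G" for F
  proof -
    obtain a where a: "a \<in> D" "F = face_of G a"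
      using F by (auto simp: black_faces_def faces_def)
    then have "a \<in> A" using F by (auto simp: arrow_iff black_faces_def white_faces_def)
    then show ?thesis using a face_face[OF e] \<open>\<And>a. a \<in> A \<Longrightarrow> a \<in> face_of G e\<close> by blast
  qed
  then have "black_faces G \<subseteq> {face_of G e}" by blast
  then have "card (black_faces G) \<le> 1"
    using card_mono[of "{face_of G e}"] by simp
  then show False
    using bij_betw_same_card[OF black_labels] d_ge_2 by simp
qed

text \<open>Vertices met by the face can be counted through the arrows of the face that enter them:
  colours along the face are distinct, so taking heads is injective.\<close>

lemma bubble_iff:
  assumes e: "e \<in> A"
  shows "bubble G (face_of G e) \<longleftrightarrow> card {f \<in> face_of G e. q f \<noteq> f} = 1"
proof -
  let ?F = "{f \<in> face_of G e. q f \<noteq> f}"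
  have inj: "inj_on (head G) ?F"
  proof (rule inj_onI)
    fix f f' assume f: "f \<in> ?F" "f' \<in> ?F" "head G f = head G f'"
    then obtain i j where ij: "i < b + 1" "f = (L ^^ i) e" "j < b + 1" "f' = (L ^^ j) e"
      unfolding in_face[OF e] mem_Collect_eq by blast
    have "i = j" by (rule c_L_pow_inj[OF e ij(1,3)]) (use f(3) ij(2,4) in simp)
    with ij show "f = f'" by simp
  qed
  have "{v\<in>vertices G. card v = 4 \<and> v \<inter> face_of G e \<noteq> {}} = head G ` ?F" (is "?V = _")
  proof
    show "head G ` ?F \<subseteq> ?V"
    proof
      fix v assume "v \<in> head G ` ?F"
      then obtain f where f: "f \<in> face_of G e" "q f \<noteq> f" "v = head G f" by auto
      have fA: "f \<in> A" using face_A[OF e f(1)] .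
      have "L f \<in> face_of G e" using face_self[of "L f"] face_face[OF e f(1)] by simp
      moreover have "L f \<in> tail G (L f)"
        unfolding vertex_of_def using permutation_self_in_orbit[OF permutation_r] .
      ultimately have "v \<inter> face_of G e \<noteq> {}" using f by auto
      then show "v \<in> ?V" using four_iff[OF fA] head_in[OF fA] f by simp
    qed
    show "?V \<subseteq> head G ` ?F"
    proof
      fix v assume v: "v \<in> ?V"
      then obtain g where g: "g \<in> v" "g \<in> face_of G e" by blast
      obtain a where "v = orbit r a" using v by (auto simp: vertices_def vertex_of_def)
      with g(1) have vg: "v = vertex_of G g"
        unfolding vertex_of_def
        using orbit_cyclic_eq3[OF cyclic_on_orbit'[OF permutation_r]] by metis
      obtain f where f: "g = L f" using surj_L by blast
      have "f \<in> face_of G e" using face_self[of f] face_face[OF e g(2)] f by simp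
      moreover have "v = head G f" using vg f by simp
      moreover have "f \<in> A" using face_A[OF e] calculation by blast
      ultimately show "v \<in> head G ` ?F" using four_iff[of f] v by auto
    qed
  qed
  then show ?thesis
    unfolding bubble_def using card_image[OF inj] by simp
qed

section \<open>Halves of labelled edges in terms of geodesic arrows\<close>

lemma geodesic_iff: "geodesic b G x0 e \<longleftrightarrow> geo e"
proof -
  have "geodesic b G x0 e \<longleftrightarrow> (of_nat (dt e + 1) :: rat) = of_nat (dh e)"
    unfolding geodesic_def edge_weight_def by (auto simp: algebra_simps add_eq_0_iff)
  then show ?thesis unfolding of_nat_eq_iff geo_def by auto
qed

lemma edge_weight_nongeo:
  assumes "e \<in> A" "\<not> geo e"
  shows "edge_weight b G x0 e = 1"
proof -
  have "(of_nat (dt e) :: rat) = of_nat (dh e) + of_nat b"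
    using dt_nongeo[OF assms] by simp
  then show ?thesis by (simp add: edge_weight_def)
qed

lemma edge_weight_geo: "geo e \<Longrightarrow> edge_weight b G x0 e = 0"
  using geodesic_iff geodesic_def by metis

lemma has_half_Black: "has_half b G x0 Black e \<longleftrightarrow> \<not> geo e"
  by (simp add: geodesic_iff)

text \<open>The case in which a weight-0 edge is drawn through the head of \<open>e\<close>, joining
  the white halves of \<open>e\<close> and \<open>q e\<close>.\<close>

definition double :: "'a \<Rightarrow> bool" where
  "double e \<longleftrightarrow> geo e \<and> q e \<noteq> e \<and> geo (q e)"

text \<open>Agrees with \<open>has_half b G x0 White\<close> on arrows, see
  \<open>has_half_White\<close>.\<close>

definition hw :: "'a \<Rightarrow> bool" where
  "hw e \<longleftrightarrow> \<not> geo e \<or> double e"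

lemma has_half_White:
  assumes e: "e \<in> A"
  shows "has_half b G x0 White e \<longleftrightarrow> hw e"
proof -
  have "geodesics_into b G x0 (head G e) = {f \<in> {e, q e}. geo f}"
    using into_head[OF e] e by (auto simp: geodesics_into_def geodesic_iff)
  moreover have "card {f \<in> {e, q e}. geo f} = 2 \<longleftrightarrow> double e"
  proof (cases "double e")
    case True
    then have "{f \<in> {e, q e}. geo f} = {e, q e}" by (auto simp: double_def)
    with True show ?thesis by (auto simp: double_def card_insert_if)
  next
    case False
    then obtain f where "{f \<in> {e, q e}. geo f} \<subseteq> {f}"
      unfolding double_def by (cases "geo e") auto
    then have "card {f \<in> {e, q e}. geo f} \<le> 1"
      using card_mono[of "{f}"] by simp
    then show ?thesis using False by simp
  qed
  ultimately show ?thesis by (simp add: geodesic_iff hw_def)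
qed

lemma double_q: "e \<in> A \<Longrightarrow> double (q e) \<longleftrightarrow> double e"
  using q_q[of e] unfolding double_def by metis

lemma opp_half_double:
  assumes "e \<in> A" "double e"
  shows "opp_half b G x0 (Lab s e) = Lab s (q e)"
proof -
  have "(THE e'. e' \<in> geodesics_into b G x0 (head G e) \<and> e' \<noteq> e) = q e"
    using assms into_head[OF assms(1)]
    by (intro the_equality) (auto simp: geodesics_into_def geodesic_iff double_def)
  then show ?thesis using assms by (simp add: geodesic_iff double_def)
qed

lemma opp_half_nongeo: "\<not> geo e \<Longrightarrow> opp_half b G x0 (Lab s e) = Lab (other_shade s) e"
  by (simp add: geodesic_iff)

section \<open>Darts of the mobile\<close>

abbreviation "S \<equiv> succ_in_face G"
abbreviation "N \<equiv> closing G"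
abbreviation "pr \<equiv> prev_node b G"
abbreviation "M \<equiv> Phi b G x0"
text \<open>The closing arrow whose region of shade \<open>s\<close> contains \<open>e\<close>: the
  colour of the head counts the steps back to it.\<close>

abbreviation "base \<equiv> \<lambda>s e. inv (succ_in_face G s ^^ colour G (head G e)) e"

lemma bij_S: "bij (S s)"
proof (cases s)
  case White
  moreover have "surj R" by (rule surjI[of _ p]) simp
  ultimately show ?thesis using inj_R by (simp add: bij_def)
next
  case Black
  then show ?thesis using inj_L surj_L by (auto simp: bij_def surj_def)
qed

lemma bij_S_pow: "bij (S s ^^ i)"
  using bij_S by (rule bij_fn)

lemma S_A [simp]: "S s e \<in> A \<longleftrightarrow> e \<in> A"
  by (cases s) simp_all

lemma S_pow_A [simp]: "(S s ^^ i) e \<in> A \<longleftrightarrow> e \<in> A"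
  by (induction i) simp_all

lemma c_S_pow: "e \<in> A \<Longrightarrow> c ((S s ^^ i) e) = (c e + i) mod (b + 1)"
  by (cases s) (simp_all add: c_L_pow c_R_pow)

lemma N_iff: "n \<in> N \<longleftrightarrow> n \<in> A \<and> c n = 0"
  by (simp add: closing_def)

lemma N_A: "n \<in> N \<Longrightarrow> n \<in> A"
  by (simp add: N_iff)

lemma c_S_pow_N: "n \<in> N \<Longrightarrow> i \<le> b \<Longrightarrow> c ((S s ^^ i) n) = i"
  using c_S_pow[of n i s] by (simp add: N_iff)

lemma base_S_pow: "n \<in> N \<Longrightarrow> i \<le> b \<Longrightarrow> base s ((S s ^^ i) n) = n"
  using c_S_pow_N inv_f_f[OF bij_is_inj[OF bij_S_pow]] by simp

lemma S_pow_base [simp]: "(S s ^^ c e) (base s e) = e"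
  using surj_f_inv_f[OF bij_is_surj[OF bij_S_pow]] .

lemma base_N: "e \<in> A \<Longrightarrow> base s e \<in> N"
proof -
  assume e: "e \<in> A"
  let ?n = "base s e"
  have n: "?n \<in> A" using e S_pow_A[where i="c e" and s=s and e="?n"] by simp
  have "c e = (c ?n + c e) mod (b + 1)"
    using c_S_pow[OF n, of "c e" s] by simp
  then have "(c e + c ?n) mod (b + 1) = (c e + 0) mod (b + 1)"
    using c_le[OF e] by (simp add: add.commute)
  then have "c ?n = 0"
    by (rule add_mod_inj[rotated 2]) (use c_le[OF n] in simp_all)
  with n show ?thesis by (simp add: N_iff)
qed

lemma S_pr [simp]: "(S s ^^ (b + 1)) (pr s n) = n"
  unfolding prev_node_def using surj_f_inv_f[OF bij_is_surj[OF bij_S_pow]] .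

lemma pr_S [simp]: "pr s ((S s ^^ (b + 1)) n) = n"
  unfolding prev_node_def using inv_f_f[OF bij_is_inj[OF bij_S_pow]] .

lemma S_period_N: "(S s ^^ (b + 1)) n \<in> N \<longleftrightarrow> n \<in> N"
proof -
  have "n \<in> A \<Longrightarrow> c ((S s ^^ (b + 1)) n) = c n"
    using c_S_pow[of n "b + 1" s] c_le[of n] by (simp only: mod_add_self2) simp
  then show ?thesis by (auto simp: N_iff simp del: funpow.simps)
qed

lemma pr_N [simp]: "pr s n \<in> N \<longleftrightarrow> n \<in> N"
  using S_period_N[of s "pr s n"] by (simp only: S_pr)

text \<open>Black faces have degree 1, so each black polygon is a loop at a single node.\<close>

lemma pr_Black: "n \<in> A \<Longrightarrow> pr Black n = n"
  using pr_S[of Black n] L_period by simp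

lemma set_region: "set (region b G s n) = (\<lambda>i. (S s ^^ i) n) ` {..b}"
  by (auto simp: region_def atMost_def less_Suc_eq_le simp del: upt_Suc)

lemma distinct_region: "n \<in> N \<Longrightarrow> distinct (region b G s n)"
  unfolding region_def distinct_map
proof (intro conjI inj_onI)
  fix i j assume n: "n \<in> N" "i \<in> set [0..<b + 1]" "j \<in> set [0..<b + 1]" "(S s ^^ i) n = (S s ^^ j) n"
  then have "i \<le> b" "j \<le> b" by (simp_all add: less_Suc_eq_le del: upt_Suc)
  from c_S_pow_N[OF n(1) this(1), of s] c_S_pow_N[OF n(1) this(2), of s] show "i = j"
    unfolding n(4) by (rule trans[OF sym])
qed simp

lemma set_around:
  "set (around b G x0 s n) =
    {Arc s n, ArcRev s (pr s n)} \<union> Lab s ` {e \<in> set (region b G s n). has_half b G x0 s e}"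
  by (cases s) (auto simp: halves_def)

lemma distinct_around: "n \<in> N \<Longrightarrow> distinct (around b G x0 s n)"
  using distinct_region[of n s] by (cases s) (auto simp: halves_def distinct_map intro!: inj_onI)

lemma node_around: "n \<in> N \<Longrightarrow> x \<in> set (around b G x0 s n) \<Longrightarrow> node b G x = (s, n)"
  using base_S_pow S_pr[of s n] by (auto simp only: set_around set_region node.simps)

lemma darts_M: "darts M = (\<Union>l\<in>node_lists b G x0. set l)"
  by (simp add: Phi_def Let_def)

lemma darts_M_iff: "x \<in> darts M \<longleftrightarrow> (\<exists>s n. n \<in> N \<and> x \<in> set (around b G x0 s n))"
  unfolding darts_M node_lists_def by blast

lemma rot_M:
  assumes "n \<in> N" "x \<in> set (around b G x0 s n)"
  shows "rot M x = cycle_of_list (around b G x0 s n) x"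
proof -
  have "x \<in> darts M" using assms darts_M_iff by blast
  moreover have "(THE l. l \<in> node_lists b G x0 \<and> x \<in> set l) = around b G x0 s n"
  proof (rule the_equality)
    show "around b G x0 s n \<in> node_lists b G x0 \<and> x \<in> set (around b G x0 s n)"
      using assms by (auto simp: node_lists_def)
    fix l assume "l \<in> node_lists b G x0 \<and> x \<in> set l"
    then obtain s' n' where l: "l = around b G x0 s' n'" "n' \<in> N" "x \<in> set l"
      by (auto simp: node_lists_def)
    then have "(s', n') = (s, n)"
      using node_around[OF l(2), of x s'] node_around[OF assms] by simp
    with l show "l = around b G x0 s n" by simp
  qed
  ultimately show ?thesis
    unfolding darts_M by (simp add: Phi_def Let_def)
qed

lemma rot_M_out: "x \<notin> darts M \<Longrightarrow> rot M x = x"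
  unfolding darts_M by (simp add: Phi_def Let_def)

lemma rot_M_around:
  assumes "n \<in> N" "x \<in> set (around b G x0 s n)"
  shows "rot M x \<in> set (around b G x0 s n)"
  unfolding rot_M[OF assms] using assms(2) by (simp only: permutes_in_image[OF cycle_permutes])

text \<open>Equal images lie at the same node, where the rotation is a cyclic permutation.\<close>

lemma inj_rot_M: "inj (rot M)"
proof (rule injI)
  fix x y assume eq: "rot M x = rot M y"
  have stay: "rot M z \<in> darts M \<longleftrightarrow> z \<in> darts M" for z
  proof (cases "z \<in> darts M")
    case True
    from True[unfolded darts_M_iff] obtain s n where n: "n \<in> N" "z \<in> set (around b G x0 s n)"
      by (elim exE conjE)
    have "rot M z \<in> darts M"
      using darts_M_iff[of "rot M z"] n(1) rot_M_around[OF n] by blast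
    with True show ?thesis by simp
  qed (simp add: rot_M_out)
  show "x = y"
  proof (cases "x \<in> darts M")
    case True
    then have "y \<in> darts M" using eq stay[of x] stay[of y] by simp
    then obtain s n s' n' where n: "n \<in> N" "x \<in> set (around b G x0 s n)"
      and n': "n' \<in> N" "y \<in> set (around b G x0 s' n')"
      using True darts_M_iff by blast
    have same: "(s, n) = (s', n')"
      using node_around[OF n(1) rot_M_around[OF n]] node_around[OF n'(1) rot_M_around[OF n']] eq by simp
    have "cycle_of_list (around b G x0 s n) x = cycle_of_list (around b G x0 s n) y"
      using rot_M[OF n] rot_M[OF n'] same eq by simp
    then show ?thesis
      by (rule injD[OF permutes_inj[OF cycle_permutes]])
  next
    case False
    then have "y \<notin> darts M" using eq stay[of x] stay[of y] by simp
    then show ?thesis using False eq rot_M_out by simp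
  qed
qed

lemma arrow_region: "e \<in> A \<Longrightarrow> e \<in> set (region b G s (base s e))"
  unfolding set_region using c_le S_pow_base[where s=s and e=e]
  by (intro image_eqI[of _ _ "c e"]) (simp_all del: S_pow_base)

lemma region_A: "n \<in> N \<Longrightarrow> e \<in> set (region b G s n) \<Longrightarrow> e \<in> A"
  by (auto simp: set_region N_A)

lemma in_darts_M [simp]:
  "Arc s n \<in> darts M \<longleftrightarrow> n \<in> N"
  "ArcRev s n \<in> darts M \<longleftrightarrow> n \<in> N"
proof -
  show "Arc s n \<in> darts M \<longleftrightarrow> n \<in> N"
    by (auto simp: darts_M_iff set_around)
  have "n \<in> N \<Longrightarrow> ArcRev s n \<in> set (around b G x0 s ((S s ^^ (b + 1)) n))"
    unfolding set_around pr_S by simp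
  then show "ArcRev s n \<in> darts M \<longleftrightarrow> n \<in> N"
    using S_period_N by (auto simp: darts_M_iff set_around simp del: funpow.simps)
qed

lemma Lab_in_darts_M: "Lab s e \<in> darts M \<longleftrightarrow> e \<in> A \<and> has_half b G x0 s e"
  using arrow_region[where e=e and s=s] base_N[where e=e and s=s] region_A
  by (auto simp: darts_M_iff set_around)

lemma Lab_White_darts [simp]: "Lab White e \<in> darts M \<longleftrightarrow> e \<in> A \<and> hw e"
  using Lab_in_darts_M has_half_White by blast

lemma Lab_Black_darts [simp]: "Lab Black e \<in> darts M \<longleftrightarrow> e \<in> A \<and> \<not> geo e"
  using Lab_in_darts_M has_half_Black by blast

lemma opp_M:
  "n \<in> N \<Longrightarrow> opp M (Arc s n) = ArcRev s n"
  "n \<in> N \<Longrightarrow> opp M (ArcRev s n) = Arc s n"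
  "e \<in> A \<Longrightarrow> double e \<Longrightarrow> opp M (Lab White e) = Lab White (q e)"
  "e \<in> A \<Longrightarrow> \<not> geo e \<Longrightarrow> opp M (Lab White e) = Lab Black e"
  "e \<in> A \<Longrightarrow> \<not> geo e \<Longrightarrow> opp M (Lab Black e) = Lab White e"
proof -
  have opp: "x \<in> darts M \<Longrightarrow> opp M x = opp_half b G x0 x" for x
    unfolding darts_M by (simp add: Phi_def Let_def)
  show "n \<in> N \<Longrightarrow> opp M (Arc s n) = ArcRev s n" "n \<in> N \<Longrightarrow> opp M (ArcRev s n) = Arc s n"
    using opp by simp_all
  show "e \<in> A \<Longrightarrow> double e \<Longrightarrow> opp M (Lab White e) = Lab White (q e)"
    using opp[of "Lab White e"] opp_half_double by (simp add: hw_def)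
  show "e \<in> A \<Longrightarrow> \<not> geo e \<Longrightarrow> opp M (Lab White e) = Lab Black e"
    "e \<in> A \<Longrightarrow> \<not> geo e \<Longrightarrow> opp M (Lab Black e) = Lab White e"
    using opp[of "Lab White e"] opp[of "Lab Black e"] opp_half_nongeo[of e] by (simp_all add: hw_def)
qed

section \<open>Rotation at the nodes and single steps of the contour\<close>

primrec nxt :: "'a \<Rightarrow> nat \<Rightarrow> 'a mdart" where
  "nxt n 0 = ArcRev White (pr White n)"
| "nxt n (Suc i) = (if hw ((R ^^ i) n) then Lab White ((R ^^ i) n) else nxt n i)"

text \<open>The final segment of \<open>around b G x0 White n\<close> that keeps only the halves of
  index below \<open>i\<close> and the reversed arc; its first entry is \<open>nxt n i\<close>. Thus
  \<open>nxt\<close> finds the dart that follows counterclockwise, with the reversed arc as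
  sentinel.\<close>

definition lower :: "'a \<Rightarrow> nat \<Rightarrow> 'a mdart list" where
  "lower n i = rev (map (Lab White) (filter (has_half b G x0 White) (map (\<lambda>i. (R ^^ i) n) [0..<i])))
     @ [ArcRev White (pr White n)]"

lemma lower_Suc:
  "n \<in> A \<Longrightarrow> lower n (Suc i) = (if hw ((R ^^ i) n) then Lab White ((R ^^ i) n) # lower n i else lower n i)"
  using has_half_White[of "(R ^^ i) n"] by (simp add: lower_def)

lemma lower_nxt: "n \<in> A \<Longrightarrow> \<exists>rest. lower n i = nxt n i # rest"
proof (induction i)
  case 0
  then show ?case by (simp add: lower_def)
next
  case (Suc i)
  then show ?case by (simp add: lower_Suc del: funpow.simps)
qed

lemma lower_append: "n \<in> A \<Longrightarrow> i \<le> j \<Longrightarrow> \<exists>xs. lower n j = xs @ lower n i"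
proof (induction j)
  case (Suc j)
  show ?case
  proof (cases "i = Suc j")
    case False
    with Suc obtain xs where "lower n j = xs @ lower n i" by auto
    then show ?thesis
      using lower_Suc[OF Suc.prems(1), of j] by (cases "hw ((R ^^ j) n)") auto
  qed simp
qed simp

lemma around_White: "around b G x0 White n = Arc White n # lower n (b + 1)"
  by (simp add: lower_def halves_def region_def)

lemma rot_Arc_White:
  assumes n: "n \<in> N"
  shows "rot M (Arc White n) = nxt n (b + 1)"
proof -
  obtain rest where "lower n (b + 1) = nxt n (b + 1) # rest"
    using lower_nxt N_A[OF n] by blast
  then have a: "around b G x0 White n = [] @ Arc White n # nxt n (b + 1) # rest"
    using around_White by simp
  have "rot M (Arc White n) = cycle_of_list (around b G x0 White n) (Arc White n)"
    using rot_M[OF n, of "Arc White n" White] by (simp add: set_around)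
  also have "\<dots> = nxt n (b + 1)"
    unfolding a by (rule cycle_of_list_next) (use distinct_around[OF n, of White] a in metis)
  finally show ?thesis .
qed

lemma rot_Lab_White_nxt:
  assumes n: "n \<in> N" and i: "i \<le> b" and h: "hw ((R ^^ i) n)"
  shows "rot M (Lab White ((R ^^ i) n)) = nxt n i"
proof -
  let ?x = "Lab White ((R ^^ i) n)"
  obtain rest where rest: "lower n i = nxt n i # rest"
    using lower_nxt N_A[OF n] by blast
  obtain xs where "lower n (b + 1) = xs @ lower n (Suc i)"
    using lower_append[OF N_A[OF n], of "Suc i" "b + 1"] i by auto
  then have a: "around b G x0 White n = (Arc White n # xs) @ ?x # nxt n i # rest"
    using around_White[of n] lower_Suc[OF N_A[OF n], of i] h rest by simp
  have "rot M ?x = cycle_of_list (around b G x0 White n) ?x"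
    by (rule rot_M[OF n]) (unfold a, simp)
  also have "\<dots> = nxt n i"
    unfolding a by (rule cycle_of_list_next) (use distinct_around[OF n, of White] a in metis)
  finally show ?thesis .
qed

text \<open>The region is the entire black face, whose only non-geodesic arrow is
  \<open>ng n\<close>, so every black node has exactly three darts.\<close>

lemma around_Black:
  assumes n: "n \<in> N"
  shows "around b G x0 Black n = [ArcRev Black n, Lab Black (ng n), Arc Black n]"
proof -
  have nA: "n \<in> A" using N_A[OF n] .
  have reg: "set (region b G Black n) = face_of G n"
    unfolding set_region face_eq[OF nA] by (simp add: lessThan_Suc_atMost)
  have "filter (has_half b G x0 Black) (region b G Black n) = [ng n]"
    by (rule filter_unique)
      (use distinct_region[OF n] ng_face[OF nA] ng_nongeo[OF nA] ng_unique[OF nA] has_half_Black reg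
       in blast)+
  then show ?thesis using pr_Black[OF nA] by (simp add: halves_def)
qed

lemma rot_Black:
  assumes n: "n \<in> N"
  shows "rot M (ArcRev Black n) = Lab Black (ng n)"
    and "rot M (Lab Black (ng n)) = Arc Black n"
    and "rot M (Arc Black n) = ArcRev Black n"
  using rot_M[OF n, of _ Black] by (simp_all add: around_Black[OF n] del: around.simps)

text \<open>\<open>nd e\<close> is the first dart met by the contour after it reaches the head of \<open>e\<close> on the white
  side, and \<open>pd e\<close> the one met after it reaches the tail of \<open>e\<close>, within the region of \<open>e\<close>.\<close>
definition nd :: "'a \<Rightarrow> 'a mdart" where "nd e = nxt (base White e) (Suc (c e))"
definition pd :: "'a \<Rightarrow> 'a mdart" where "pd e = nxt (base White e) (c e)"

lemma nd_eq: "e \<in> A \<Longrightarrow> nd e = (if hw e then Lab White e else pd e)"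
  using S_pow_base[where s=White and e=e] by (simp add: nd_def pd_def)

lemma rot_Lab_White: "e \<in> A \<Longrightarrow> hw e \<Longrightarrow> rot M (Lab White e) = pd e"
  using rot_Lab_White_nxt[OF base_N[where e=e and s=White] c_le[of e]] S_pow_base[where s=White and e=e]
  by (simp add: pd_def)

lemma p_S_Suc: "p ((R ^^ Suc i) n) = (R ^^ i) n"
  by simp

lemma pd_pos:
  assumes e: "e \<in> A" and pos: "c e \<noteq> 0"
  shows "pd e = nd (p e)"
proof -
  obtain i where i: "c e = Suc i" using pos by (cases "c e") auto
  define n where "n = base White e"
  have n: "n \<in> N" unfolding n_def using base_N[OF e, where s=White] .
  have "(R ^^ Suc i) n = e" using S_pow_base[where s=White and e=e] i by (simp add: n_def)
  then have pe: "p e = (R ^^ i) n" using p_S_Suc by blast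
  have "i \<le> b" using c_le[OF e] i by simp
  then have "c (p e) = i" "base White (p e) = n"
    using c_S_pow_N[OF n, where i=i and s=White] base_S_pow[OF n, where i=i and s=White] pe by simp_all
  then show ?thesis unfolding pd_def nd_def n_def[symmetric] by (simp only: i)
qed

text \<open>One step back from a closing arrow leaves its region and enters the region of the
  previous white node at its last vertex, of colour \<open>b\<close>.\<close>

lemma
  assumes n: "n \<in> N"
  shows p_N: "p n = (R ^^ b) (pr White n)"
    and pd_N: "pd n = ArcRev White (pr White n)"
    and c_p_N: "c (p n) = b"
    and nd_p_N: "nd (p n) = nxt (pr White n) (b + 1)"
proof -
  have "(R ^^ Suc b) (pr White n) = n" using S_pr[of White n] by simp
  then show pn: "p n = (R ^^ b) (pr White n)" using p_S_Suc by metis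
  have prN: "pr White n \<in> N" using n by simp
  have "base White n = n" using base_S_pow[OF n, where i=0 and s=White] by simp
  then show "pd n = ArcRev White (pr White n)" using n by (simp add: pd_def N_iff)
  show cb: "c (p n) = b" using c_S_pow_N[OF prN, where i=b and s=White] pn by simp
  have "base White (p n) = pr White n" using base_S_pow[OF prN, where i=b and s=White] pn by simp
  then show "nd (p n) = nxt (pr White n) (b + 1)" unfolding nd_def cb by simp
qed

lemma RS_ArcRev_White: "n \<in> N \<Longrightarrow> right_succ M (ArcRev White (pr White n)) = nd (p n)"
  by (simp add: right_succ_def opp_M rot_Arc_White nd_p_N del: nxt.simps)

lemma RS_double: "e \<in> A \<Longrightarrow> double e \<Longrightarrow> right_succ M (Lab White e) = pd (q e)"
  using double_q[of e] by (simp add: right_succ_def opp_M rot_Lab_White hw_def)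

text \<open>Together with \<open>RS_Arc_Black\<close>: the contour crosses \<open>e\<close> to the
  black node, runs once around the loop, comes back through the same edge and continues on the tail
  side of \<open>e\<close>.\<close>

lemma RS_nongeo:
  assumes e: "e \<in> A" "\<not> geo e"
  shows "right_succ M (Lab White e) = Arc Black (base Black e)"
    and "right_succ M (Lab Black e) = pd e"
proof -
  have "e \<in> face_of G (base Black e)"
    using S_pow_base[where s=Black and e=e] c_le[OF e(1)]
    unfolding in_face[OF N_A[OF base_N[OF e(1), where s=Black]]]
    by (intro exI[of _ "c e"]) (simp del: S_pow_base)
  then have "ng (base Black e) = e"
    using ng_unique[OF N_A[OF base_N[OF e(1), where s=Black]]] e(2) by simp
  then show "right_succ M (Lab White e) = Arc Black (base Black e)"
    using rot_Black(2)[OF base_N[OF e(1), where s=Black]] e by (simp add: right_succ_def opp_M)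
  show "right_succ M (Lab Black e) = pd e"
    using e by (simp add: right_succ_def opp_M rot_Lab_White hw_def)
qed

lemma ng_base_Black:
  assumes e: "e \<in> A"
  shows "ng (base Black e) = ng e" and "face_of G (base Black e) = face_of G e"
proof -
  have "face_of G ((L ^^ c e) (base Black e)) = face_of G (base Black e)" by (rule face_L_pow)
  moreover have "(L ^^ c e) (base Black e) = e" using S_pow_base[where s=Black and e=e] by simp
  ultimately show "face_of G (base Black e) = face_of G e" by (simp only:)
  then show "ng (base Black e) = ng e" by (simp add: ng_def)
qed

lemma RS_Arc_Black: "n \<in> N \<Longrightarrow> right_succ M (Arc Black n) = Lab Black (ng n)"
  by (simp add: right_succ_def opp_M rot_Black)

section \<open>The contour of the mobile\<close>

abbreviation "RS \<equiv> right_succ M"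

lemma c_p: "e \<in> A \<Longrightarrow> c e \<noteq> 0 \<Longrightarrow> c e = Suc (c (p e))"
  using colour_step[of e] c_le[of "p e"] by (cases "c (p e) = b") auto

text \<open>The darts of the mobile without a polygon interior on their right: white arcs run
  clockwise and so occur reversed, black arcs run counterclockwise and occur forwards.\<close>

fun contour :: "'a mdart \<Rightarrow> bool" where
  "contour (Lab White e) \<longleftrightarrow> e \<in> A \<and> hw e"
| "contour (Lab Black e) \<longleftrightarrow> e \<in> A \<and> \<not> geo e"
| "contour (ArcRev White m) \<longleftrightarrow> m \<in> N"
| "contour (ArcRev Black m) \<longleftrightarrow> False"
| "contour (Arc White n) \<longleftrightarrow> False"
| "contour (Arc Black n) \<longleftrightarrow> n \<in> N"

text \<open>Along the contour of the mobile, \<open>\<delta>\<close> minus the colour only changes at polygon arcs: it grows by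
  \<open>b + 1\<close> at a black arc and drops by \<open>b + 1\<close> at a white one.\<close>
fun pot :: "'a mdart \<Rightarrow> int" where
  "pot (Lab White e) = int (dh e) - int (c e)"
| "pot (Lab Black e) = int (dt e) + 1 - int (c e)"
| "pot (ArcRev s m) = int (dh ((R ^^ b) m)) + 1"
| "pot (Arc s n) = int (dh (ng n)) - int (c (ng n))"

text \<open>Induction on the colour: an arrow without a white half is geodesic, so passing it
  backwards lowers distance and colour by one each. At colour 0 the reversed white arc is met, whose
  potential refers to the last arrow of the previous region.\<close>

lemma contour_pot_pd:
  "e \<in> A \<Longrightarrow> contour (pd e) \<and> pot (pd e) = int (dt e) + 1 - int (c e)"
proof (induction "c e" arbitrary: e)
  case 0
  then have e: "e \<in> N" by (simp add: N_iff)
  then have "pr White e \<in> N" by simp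
  then show ?case
    unfolding pd_N[OF e] using p_N[OF e, symmetric] 0(1)[symmetric] by simp
next
  case (Suc k)
  have "c e \<noteq> 0" using Suc.hyps(2) by simp
  note eqs = pd_pos[OF Suc.prems this] c_p[OF Suc.prems this]
  have pA: "p e \<in> A" using Suc.prems by simp
  have "k = c (p e)" using Suc.hyps(2) eqs(2) by simp
  from Suc.hyps(1)[OF this pA] show ?case
    unfolding eqs nd_eq[OF pA] using pA by (auto simp: hw_def geo_def)
qed

lemma contour_pd: "e \<in> A \<Longrightarrow> contour (pd e)" and pot_pd: "e \<in> A \<Longrightarrow> pot (pd e) = int (dt e) + 1 - int (c e)"
  using contour_pot_pd by blast+

lemma contour_nd: "e \<in> A \<Longrightarrow> contour (nd e)"
  using contour_pd by (simp add: nd_eq)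

lemma pot_nd: "e \<in> A \<Longrightarrow> pot (nd e) = int (dh e) - int (c e)"
  using pot_pd[of e] by (auto simp: nd_eq hw_def geo_def)

lemma arc_darts_M: "arc_darts M s = Arc s ` N \<union> ArcRev s ` N"
proof -
  have "arcs M s = Arc s ` N" by (simp add: Phi_def Let_def)
  then show ?thesis by (auto simp: arc_darts_def opp_M image_iff)
qed

lemma RS_ArcRev:
  assumes "m \<in> N"
  shows "RS (ArcRev White m) = nd ((R ^^ b) m)" and "c ((R ^^ b) m) = b"
proof -
  define n where "n = (S White ^^ (b + 1)) m"
  have n: "n \<in> N" unfolding n_def S_period_N by (fact assms)
  have m: "pr White n = m" unfolding n_def by (rule pr_S)
  show "RS (ArcRev White m) = nd ((R ^^ b) m)" "c ((R ^^ b) m) = b"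
    using RS_ArcRev_White[OF n] p_N[OF n] c_p_N[OF n] by (simp_all add: m)
qed

text \<open>Steps along labelled edges keep the potential. A white arc goes from colour 0 back to
  colour \<open>b\<close> and loses \<open>b + 1\<close>; a black loop goes from the head side to
  the tail side of an arrow with \<open>dt = dh + b\<close> and gains \<open>b + 1\<close>.\<close>

lemma RS_contour:
  assumes "contour x"
  shows "contour (RS x)"
    and "pot (RS x) = pot x + int (b + 1) * (of_bool (x \<in> arc_darts M Black) - of_bool (x \<in> arc_darts M White))"
proof -
  have "contour (RS x) \<and> pot (RS x) = pot x + int (b + 1) * (of_bool (x \<in> arc_darts M Black) - of_bool (x \<in> arc_darts M White))"
    using assms
  proof (cases x rule: contour.cases)
    case (1 e)
    show ?thesis
    proof (cases "geo e")
      case True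
      then have e: "e \<in> A" "double e" "geo (q e)" using assms 1 by (auto simp: hw_def double_def)
      show ?thesis
        unfolding 1 RS_double[OF e(1,2)] arc_darts_M
        using contour_pd[of "q e"] pot_pd[of "q e"] e(1,3) by (auto simp: geo_def)
    next
      case False
      have e: "e \<in> A" using assms 1 by simp
      show ?thesis
        unfolding 1 RS_nongeo[OF e False] arc_darts_M
        using base_N[OF e, where s=Black] ng_base_Black(1)[OF e] ng_self[OF e False] by auto
    qed
  next
    case (2 e)
    then have e: "e \<in> A" "\<not> geo e" using assms by auto
    show ?thesis
      unfolding 2 RS_nongeo[OF e] arc_darts_M using contour_pd[OF e(1)] pot_pd[OF e(1)] by auto
  next
    case (3 m)
    then have m: "m \<in> N" using assms by simp
    then show ?thesis
      unfolding 3 RS_ArcRev(1)[OF m] arc_darts_M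
      using contour_nd[of "(R ^^ b) m"] pot_nd[of "(R ^^ b) m"] RS_ArcRev(2)[OF m] N_A[OF m] by auto
  next
    case (6 n)
    then have n: "n \<in> N" using assms by simp
    then show ?thesis
      unfolding 6 RS_Arc_Black[OF n] arc_darts_M
      using ng_nongeo[OF N_A[OF n]] dt_ng[OF N_A[OF n]] N_A[OF n] by auto
  qed auto
  then show "contour (RS x)"
    "pot (RS x) = pot x + int (b + 1) * (of_bool (x \<in> arc_darts M Black) - of_bool (x \<in> arc_darts M White))"
    by blast+
qed

lemma contour_RS_pow: "contour x \<Longrightarrow> contour ((RS ^^ k) x)"
  by (induction k) (simp_all add: RS_contour)

lemma pot_RS_pow:
  assumes "contour x"
  shows "pot ((RS ^^ k) x) = pot x + int (b + 1) *
    (int (card {j. j < k \<and> (RS ^^ j) x \<in> arc_darts M Black}) -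
     int (card {j. j < k \<and> (RS ^^ j) x \<in> arc_darts M White}))"
proof (induction k)
  case (Suc k)
  have "pot ((RS ^^ Suc k) x) = pot ((RS ^^ k) x) + int (b + 1) *
      (of_bool ((RS ^^ k) x \<in> arc_darts M Black) - of_bool ((RS ^^ k) x \<in> arc_darts M White))"
    using RS_contour(2)[OF contour_RS_pow[OF assms]] by simp
  then show ?case
    unfolding Suc.IH card_less_Suc of_nat_add of_nat_of_bool by (simp only: algebra_simps)
qed simp

section \<open>Orbits of the contour\<close>

lemma finite_darts_M: "finite (darts M)"
proof -
  have "node_lists b G x0 \<subseteq> around b G x0 White ` N \<union> around b G x0 Black ` N"
  proof
    fix l assume "l \<in> node_lists b G x0"
    then obtain s n where "l = around b G x0 s n" "n \<in> N" by (auto simp: node_lists_def)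
    then show "l \<in> around b G x0 White ` N \<union> around b G x0 Black ` N" by (cases s) auto
  qed
  moreover have "finite N" using finite_A N_A by (meson finite_subset subsetI)
  ultimately have "finite (node_lists b G x0)" by (meson finite_UnI finite_imageI finite_subset)
  then show ?thesis unfolding darts_M by auto
qed

lemma opp_M_darts:
  assumes "x \<in> darts M"
  shows "opp M x \<in> darts M \<and> opp M (opp M x) = x"
proof (cases x)
  case (Lab s e)
  show ?thesis
  proof (cases "double e")
    case True
    then have "s = White" "e \<in> A" using assms Lab by (cases s; auto simp: double_def)+
    then show ?thesis using True double_q[of e] q_q[of e] by (simp add: Lab opp_M hw_def)
  next
    case False
    then have "e \<in> A" "\<not> geo e" using assms Lab by (cases s; auto simp: hw_def)+
    then show ?thesis by (cases s) (simp_all add: Lab opp_M hw_def)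
  qed
qed (use assms in \<open>simp_all add: opp_M\<close>)

text \<open>Makes the orbits of \<open>RS\<close> equivalence classes that are exhausted by forward
  iteration.\<close>

lemma permutation_RS: "permutation RS"
proof -
  have "rot M permutes darts M"
  proof (rule permutes_if_inj)
    show "rot M ` darts M \<subseteq> darts M"
    proof
      fix y assume "y \<in> rot M ` darts M"
      then obtain x where x: "x \<in> darts M" "y = rot M x" by blast
      from x(1)[unfolded darts_M_iff] obtain s n where n: "n \<in> N" "x \<in> set (around b G x0 s n)"
        by (elim exE conjE)
      show "y \<in> darts M"
        unfolding x(2) darts_M_iff using n(1) rot_M_around[OF n] by blast
    qed
  qed (use finite_darts_M inj_rot_M rot_M_out in \<open>auto intro: inj_on_subset\<close>)
  moreover have "opp M permutes darts M"
  proof (rule permutes_if_inj)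
    show "inj_on (opp M) (darts M)"
      by (rule inj_on_inverseI[of _ "opp M"]) (use opp_M_darts in blast)
    show "opp M x = x" if "x \<notin> darts M" for x
      using that unfolding darts_M by (simp add: Phi_def Let_def)
  qed (use finite_darts_M opp_M_darts in auto)
  ultimately have "rot M \<circ> opp M permutes darts M" by (rule permutes_compose[rotated])
  moreover have "rot M \<circ> opp M = RS" by (auto simp: right_succ_def)
  ultimately show ?thesis using finite_darts_M permutation_permutes by metis
qed

abbreviation "orb \<equiv> orbit RS"

lemma orb_RS: "orb (RS x) = orb x"
  using permutation_RS by (rule permutation_orbit_step)

lemma orb_pd: "e \<in> A \<Longrightarrow> orb (pd e) = orb (nd (p e))"
proof (cases "c e = 0")
  case True
  moreover assume "e \<in> A"
  ultimately have "e \<in> N" by (simp add: N_iff)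
  then show ?thesis using orb_RS[of "pd e"] RS_ArcRev_White pd_N by simp
qed (simp add: pd_pos)

lemma orb_nongeo:
  assumes "e \<in> A" "\<not> geo e"
  shows "orb (Lab White e) = orb (Lab Black e)" "orb (Lab Black e) = orb (pd e)"
proof -
  have "RS (RS (Lab White e)) = Lab Black e"
    using RS_nongeo(1)[OF assms] RS_Arc_Black[OF base_N[OF assms(1), where s=Black]] ng_base_Black(1)[OF assms(1)]
      ng_self[OF assms] by simp
  then show "orb (Lab White e) = orb (Lab Black e)" using orb_RS by metis
  show "orb (Lab Black e) = orb (pd e)" using orb_RS[of "Lab Black e"] RS_nongeo(2)[OF assms] by simp
qed

lemma orb_double: "e \<in> A \<Longrightarrow> double e \<Longrightarrow> orb (Lab White e) = orb (pd (q e))"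
  using orb_RS[of "Lab White e"] RS_double by simp

abbreviation "bd \<equiv> \<lambda>e. Lab Black (ng e)"

text \<open>The edges of \<open>G\<close> not crossed by the mobile form a tree of geodesics rooted at \<open>x0\<close>; the contour
  runs around each subtree, entering it on the black side of its lowest edge and leaving it on the
  white side.\<close>
lemma orb_bd: "e \<in> A \<Longrightarrow> orb (bd e) = orb (pd e)"
\<comment> \<open>Induction on decreasing distance from \<open>x0\<close>, from the leaves of the
  tree towards its root.\<close>
proof (induction "Max (dh ` A) - dh e" arbitrary: e rule: less_induct)
  case less
  note e = less.prems
  show ?case
  proof (cases "geo e")
    case False
    then show ?thesis using orb_nongeo[OF e] ng_self[OF e] by simp
  next
    case True
    \<comment> \<open>This treats any arrow \<open>g\<close> leaving the head of \<open>e\<close>.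
      If it is geodesic the induction applies; otherwise its black half leads straight to
      \<open>pd g\<close>.\<close>
    have IH: "orb (bd g) = orb (nd (p g))" if g: "g \<in> A" "tail G g = head G e" for g
    proof (cases "geo g")
      case False
      then show ?thesis using orb_nongeo[OF g(1)] ng_self[OF g(1)] orb_pd[OF g(1)] by simp
    next
      case True
      have "dh g \<le> Max (dh ` A)" using g(1) finite_A by simp
      moreover have "dh g = dh e + 1" using True g(2) by (simp add: geo_def)
      ultimately have "orb (bd g) = orb (pd g)" using less.hyps[of g] g(1) by simp
      then show ?thesis using orb_pd[OF g(1)] by simp
    qed
    have *: "orb (bd e) = orb (nd (q e))" using IH[of "L e"] e by simp
    consider "q e = e" | "q e \<noteq> e" "\<not> geo (q e)" | "double e"
      using True by (auto simp: double_def)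
    then show ?thesis
    proof cases
      case 1
      then have "\<not> hw e" using True by (simp add: hw_def double_def)
      then show ?thesis using * 1 e by (simp add: nd_eq)
    next
      \<comment> \<open>After the subtree of \<open>L e\<close> the contour crosses
        \<open>q e\<close>, goes around its black polygon, and runs around the subtree of
        \<open>R e\<close>, which lies on the same black face as \<open>q e\<close>.\<close>
      case 2
      have qA: "q e \<in> A" using e by simp
      have "orb (nd (q e)) = orb (bd (q e))"
        using 2 qA orb_nongeo(1)[OF qA] ng_self[OF qA] by (simp add: nd_eq hw_def)
      also have "bd (q e) = bd (R e)"
        using ng_L[of "q e"] L_q[OF e] by simp
      also have "orb (bd (R e)) = orb (nd e)" using IH[of "R e"] e by simp
      also have "nd e = pd e" using 2 True e by (simp add: nd_eq hw_def double_def)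
      finally show ?thesis using * by simp
    next
      \<comment> \<open>The weight-0 edge splits the vertex: only \<open>L e\<close> continues
        \<open>e\<close>, and the edge leads from \<open>q e\<close> back to
        \<open>pd e\<close>.\<close>
      case 3
      have "nd (q e) = Lab White (q e)" using 3 double_q[OF e] e by (simp add: nd_eq hw_def)
      moreover have "orb (Lab White (q e)) = orb (pd e)"
        using orb_double[of "q e"] 3 double_q[OF e] q_q[OF e] e by simp
      ultimately show ?thesis using * by simp
    qed
  qed
qed

text \<open>Induction on the distance of the tail. With \<open>e = L f\<close>, the arrows
  \<open>e\<close> and \<open>f\<close> share a black face, so a geodesic \<open>f\<close> is a
  nearer representative. If \<open>f\<close> is not geodesic then \<open>q f\<close> is, and
  \<open>orb_bd\<close> for \<open>L (q f)\<close> joins the face of \<open>q f\<close> to that of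
  \<open>f\<close>.\<close>

lemma orb_bd_const:
  assumes "e0 \<in> A" "head G e0 = x0" "e \<in> A"
  shows "orb (bd e) = orb (bd e0)"
  using assms(3)
proof (induction "dt e" arbitrary: e rule: less_induct)
  case less
  note e = less.prems
  show ?case
  proof (cases "tail G e = x0")
    case True
    have "q e0 = e0" using q_eq_of_c_0[OF assms(1)] assms(2) colour_x0 by simp
    then have "L e0 = R e0" using R_q[of e0] by simp
    then have "e = L e0" using out_of_head[OF assms(1) e] True assms(2) by simp
    then show ?thesis by simp
  next
    case False
    obtain f where f: "e = L f" using surj_L by blast
    have fA: "f \<in> A" using e f by simp
    have hf: "head G f = tail G e" using f by simp
    show ?thesis
    proof (cases "geo f")
      case True
      then have "dt f < dt e" using hf by (simp add: geo_def)
      from less.hyps[OF this fA] show ?thesis using f by simp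
    next
      case ng: False
      have qf: "geo (q f)" using nongeo_head[OF fA ng] hf False by metis
      have qA: "q f \<in> A" using fA by simp
      have "dt (q f) < dt e" using qf hf by (simp add: geo_def)
      note IH = less.hyps[OF this qA]
      have "orb (bd (q f)) = orb (bd (L (q f)))" by simp
      also have "\<dots> = orb (nd (q (q f)))"
        using orb_bd[of "L (q f)"] orb_pd[of "L (q f)"] qA by simp
      also have "\<dots> = orb (Lab White f)"
        using fA ng by (simp add: q_q nd_eq hw_def)
      also have "\<dots> = orb (bd e)" using orb_nongeo(1)[OF fA ng] ng_self[OF fA ng] f by simp
      finally show ?thesis using IH by simp
    qed
  qed
qed

lemma reach:
  assumes "e \<in> A" "hw e" "f \<in> A" "hw f"
  shows "\<exists>k. (RS ^^ k) (Lab White e) = Lab White f"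
proof -
  obtain e0 where e0: "e0 \<in> A" "head G e0 = x0" using ex_arrow_into[OF x0_vertex] by blast
  have "orb (Lab White e) = orb (bd e0)" if e: "e \<in> A" "hw e" for e
  proof (cases "geo e")
    case True
    then have "double e" using e by (simp add: hw_def)
    then show ?thesis
      using orb_double[OF e(1)] orb_bd[of "q e"] orb_bd_const[OF e0, of "q e"] e(1) by simp
  next
    case False
    then show ?thesis
      using orb_nongeo(1)[OF e(1)] ng_self[OF e(1)] orb_bd_const[OF e0 e(1)] by simp
  qed
  from this[OF assms(1,2)] this[OF assms(3,4)]
  have "Lab White f \<in> orb (Lab White e)"
    using permutation_self_in_orbit[OF permutation_RS, of "Lab White f"] by simp
  then show ?thesis unfolding orbit_altdef_permutation[OF permutation_RS] by auto
qed

lemma inj_RS: "inj RS"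
  using permutation_RS by (simp add: bij_is_inj permutation_bijective)

section \<open>Interruption and bubbles\<close>

abbreviation "E \<equiv> \<lambda>e. edge_of M (Lab White e)"

lemma E_nongeo: "e \<in> A \<Longrightarrow> \<not> geo e \<Longrightarrow> E e = {Lab White e, Lab Black e}"
  by (simp add: edge_of_def opp_M)

lemma E_double: "e \<in> A \<Longrightarrow> double e \<Longrightarrow> E e = {Lab White e, Lab White (q e)}"
  by (simp add: edge_of_def opp_M)

lemma E_cases:
  assumes "e \<in> A" "hw e"
  obtains "\<not> geo e" "E e = {Lab White e, Lab Black e}"
  | "double e" "E e = {Lab White e, Lab White (q e)}"
  using E_nongeo E_double assms unfolding hw_def by blast

lemma Lab_in_E:
  assumes "e \<in> A" "hw e" "x \<in> E e"
  shows "\<exists>s f. x = Lab s f \<and> f \<in> A \<and> head G f = head G e"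
  using assms by (cases rule: E_cases[OF assms(1,2)]) auto

lemma labelled_M: "labelled_edges M = E ` {e \<in> A. hw e}"
proof
  have "x \<in> darts M \<Longrightarrow> x \<notin> arc_darts M White \<Longrightarrow> x \<notin> arc_darts M Black \<Longrightarrow>
    \<exists>e\<in>A. hw e \<and> edge_of M x = E e" for x
  proof (cases x)
    case (Arc s n)
    assume "x \<in> darts M" "x \<notin> arc_darts M White" "x \<notin> arc_darts M Black"
    then show ?thesis using Arc by (cases s) (auto simp: arc_darts_M)
  next
    case (ArcRev s n)
    assume "x \<in> darts M" "x \<notin> arc_darts M White" "x \<notin> arc_darts M Black"
    then show ?thesis using ArcRev by (cases s) (auto simp: arc_darts_M)
  next
    case (Lab s e)
    assume "x \<in> darts M"
    then have "e \<in> A \<and> hw e \<and> edge_of M x = E e"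
      using Lab by (cases s) (auto simp: hw_def edge_of_def opp_M)
    then show ?thesis by blast
  qed
  then show "labelled_edges M \<subseteq> E ` {e \<in> A. hw e}"
    unfolding labelled_edges_def by blast
  show "E ` {e \<in> A. hw e} \<subseteq> labelled_edges M"
    unfolding labelled_edges_def by (auto simp: arc_darts_M)
qed

lemma E_labelled: "e \<in> A \<Longrightarrow> hw e \<Longrightarrow> E e \<in> labelled_edges M"
  by (simp add: labelled_M)

lemma E_disjoint:
  assumes "e \<in> A" "hw e" "f \<in> A" "hw f" "x \<in> E e" "x \<in> E f"
  shows "E e = E f"
proof -
  have "E e = edge_of M x" if "e \<in> A" "hw e" "x \<in> E e" for e
    using that opp_M_darts[of "Lab White e"] by (auto simp: edge_of_def)
  with assms show ?thesis by blast
qed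

lemma Lab_E [simp]: "Lab White f \<in> E f"
  by (simp add: edge_of_def)

lemma E_eq_nongeo: "e \<in> A \<Longrightarrow> \<not> geo e \<Longrightarrow> E f = E e \<Longrightarrow> f = e"
  using E_nongeo[of e] Lab_E[of f] by simp

lemma elabel_E:
  assumes "e \<in> A" "hw e"
  shows "elabel M (E e) = c e"
proof -
  have "elabel M y = (THE k. \<exists>s f. Lab s f \<in> y \<and> k = c f)" for y
    by (simp add: Phi_def Let_def)
  moreover have "(THE k. \<exists>s f. Lab s f \<in> E e \<and> k = c f) = c e"
  proof (rule the_equality)
    show "\<exists>s f. Lab s f \<in> E e \<and> c e = c f" by (auto simp: edge_of_def)
    fix k assume "\<exists>s f. Lab s f \<in> E e \<and> k = c f"
    then show "k = c e" using Lab_in_E[OF assms] by fastforce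
  qed
  ultimately show ?thesis by simp
qed

lemma eweight_E:
  assumes "e \<in> A" "hw e"
  shows "eweight M (E e) = (if geo e then 0 else 1)"
proof -
  have "eweight M y = (THE w. \<exists>s f. Lab s f \<in> y \<and> w = edge_weight b G x0 f)" for y
    by (simp add: Phi_def Let_def)
  moreover have "(THE w. \<exists>s f. Lab s f \<in> E e \<and> w = edge_weight b G x0 f) = (if geo e then 0 else 1)"
  proof (cases rule: E_cases[OF assms])
    case 1
    then have "(\<exists>s f. Lab s f \<in> E e \<and> w = edge_weight b G x0 f) \<longleftrightarrow> w = 1" for w
      using edge_weight_nongeo[OF assms(1) 1(1)] by (cases "w = 1") fastforce+
    then show ?thesis using 1(1) by simp
  next
    case 2
    then have "(\<exists>s f. Lab s f \<in> E e \<and> w = edge_weight b G x0 f) \<longleftrightarrow> w = 0" for w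
      using edge_weight_geo[of e] edge_weight_geo[of "q e"]
      by (cases "w = 0") (fastforce simp: double_def)+
    then show ?thesis using 2(1) by (simp add: double_def)
  qed
  ultimately show ?thesis by simp
qed

lemma arcs_M: "arcs M s = Arc s ` N"
  by (simp add: Phi_def Let_def)

lemma vertex_Arc_Black:
  assumes n: "n \<in> N"
  shows "vertex_of M (Arc Black n) = {ArcRev Black n, Lab Black (ng n), Arc Black n}"
proof -
  have "(rot M ^^ 3) (Arc Black n) = Arc Black n"
    using rot_Black[OF n] by (simp add: eval_nat_numeral)
  from orbit_altdef_bounded[OF this] have "vertex_of M (Arc Black n) = {(rot M ^^ m) (Arc Black n) |m. m < 3}"
    by (simp add: vertex_of_def)
  also have "\<dots> = (\<lambda>m. (rot M ^^ m) (Arc Black n)) ` {0, 1, 2}"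
  proof -
    have "{0, 1, 2} = {m. m < (3::nat)}" by auto
    then show ?thesis by (simp only: setcompr_eq_image)
  qed
  also have "\<dots> = {ArcRev Black n, Lab Black (ng n), Arc Black n}"
    using rot_Black[OF n] by (auto simp: eval_nat_numeral)
  finally show ?thesis .
qed

lemma face_Arc_Black:
  assumes n: "n \<in> N"
  shows "face_of M (Arc Black n) = {Arc Black n}"
proof -
  have "inv (rot M) (ArcRev Black n) = Arc Black n"
    using inj_rot_M rot_Black(3)[OF n] by (rule inv_f_eq)
  then show ?thesis
    unfolding face_of_def orbit_eq_singleton_iff left_succ_def using opp_M(1)[OF n] by simp
qed

lemma Lab_Black_in_E: "f \<in> A \<Longrightarrow> hw f \<Longrightarrow> Lab Black e \<in> E f \<Longrightarrow> \<not> geo f \<and> e = f"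
  by (cases rule: E_cases) auto

lemma polygon_edge_M:
  assumes n: "n \<in> N"
  shows "polygon_edge M {Arc Black n} = E (ng n)"
proof -
  have e: "ng n \<in> A" "\<not> geo (ng n)" using N_A[OF n] ng_nongeo by auto
  then have h: "hw (ng n)" by (simp add: hw_def)
  show ?thesis
    unfolding polygon_edge_def
  proof (rule the_equality)
    show "E (ng n) \<in> labelled_edges M \<and>
      (\<exists>x\<in>E (ng n). \<exists>p\<in>{Arc Black n}. x \<in> vertex_of M p) \<and> eweight M (E (ng n)) = 1"
      using E_labelled[OF e(1) h] eweight_E[OF e(1) h] e(2) E_nongeo[OF e] vertex_Arc_Black[OF n]
      by auto
    fix y assume y: "y \<in> labelled_edges M \<and> (\<exists>x\<in>y. \<exists>p\<in>{Arc Black n}. x \<in> vertex_of M p) \<and> eweight M y = 1"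
    then obtain f x where f: "f \<in> A" "hw f" "y = E f" "x \<in> E f" "x \<in> vertex_of M (Arc Black n)"
      unfolding labelled_M by blast
    have "x = Lab Black (ng n)" using f(5) Lab_in_E[OF f(1,2,4)] vertex_Arc_Black[OF n] by auto
    then show "y = E (ng n)" using Lab_Black_in_E[OF f(1,2), of "ng n"] f(3,4) by simp
  qed
qed

lemma towards_black_E:
  assumes e: "e \<in> A" "\<not> geo e"
  shows "towards_black M (E e) = Lab White e"
  unfolding towards_black_def
proof (rule the_equality)
  have "Lab Black e \<in> vertex_of M (Arc Black (base Black e))"
    using vertex_Arc_Black[OF base_N[OF e(1), where s=Black]] ng_base_Black(1)[OF e(1)] ng_self[OF e] by simp
  then show "Lab White e \<in> E e \<and> (\<exists>p\<in>arcs M Black. opp M (Lab White e) \<in> vertex_of M p)"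
    unfolding arcs_M using base_N[OF e(1), where s=Black] opp_M(4)[OF e] E_nongeo[OF e] by auto
  fix a assume a: "a \<in> E e \<and> (\<exists>p\<in>arcs M Black. opp M a \<in> vertex_of M p)"
  have "a \<noteq> Lab Black e"
    using a opp_M(5)[OF e] vertex_Arc_Black by (auto simp: arcs_M)
  with a show "a = Lab White e" using E_nongeo[OF e] by auto
qed

lemma ccw_E: "e \<in> A \<Longrightarrow> \<not> geo e \<Longrightarrow> ccw_path M (E e) k = (RS ^^ k) (Lab White e)"
  by (simp add: ccw_path_def towards_black_E)

lemma RS_RS_nongeo: "e \<in> A \<Longrightarrow> \<not> geo e \<Longrightarrow> RS (RS (Lab White e)) = Lab Black e"
  using RS_nongeo(1)[of e] RS_Arc_Black[OF base_N[where e=e and s=Black]] ng_base_Black(1)[of e]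
    ng_self[of e] by simp

text \<open>A label 0 can occur only at \<open>x0\<close>, which has one incoming arrow. A nonzero
  label occurs only at the four-valent vertex of that colour, where the other arrow
  \<open>q e\<close> carries no half. This excludes ties of labels in
  \<open>interrupted_iff\<close>.\<close>

lemma E_label_eq:
  assumes e: "e \<in> A" "\<not> geo e" and f: "f \<in> A" "hw f" and eq: "c e = c f"
  shows "f = e"
proof (cases "q e = e")
  case True
  then have "head G e = x0" using nongeo_head[OF e] by auto
  then have "c f = 0" using eq colour_x0 by simp
  then have qf: "q f = f" using q_eq_of_c_0[OF f(1)] by simp
  then have "\<not> geo f" using f(2) by (auto simp: hw_def double_def)
  then have "head G f = x0" using nongeo_head[OF f(1)] qf by auto
  then show ?thesis using into_head[OF e(1) f(1)] \<open>head G e = x0\<close> True by auto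
next
  case False
  then have "geo (q e)" "c e \<noteq> 0" using nongeo_head[OF e] q_eq_of_c_0[OF e(1)] by auto
  have "q f \<noteq> f"
  proof (cases "geo f")
    case True
    then show ?thesis using f by (auto simp: hw_def double_def)
  next
    case False
    then show ?thesis using nongeo_head[OF f(1)] \<open>c e \<noteq> 0\<close> eq colour_x0 by auto
  qed
  then have "f = e \<or> f = q e" using same_four_colour[OF e(1) f(1) False _ eq] by simp
  moreover have "\<not> hw (q e)" using \<open>geo (q e)\<close> e(2) q_q[OF e(1)] by (simp add: hw_def double_def)
  ultimately show ?thesis using f(2) by auto
qed

text \<open>The change of potential up to the first contact with \<open>E f\<close> is
  \<open>b + 1\<close> times the black minus the white arc distance. As labels lie between 0 and
  \<open>b\<close>, comparing first these arc distances and then the labels amounts to comparing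
  \<open>dh e\<close> with \<open>dh f\<close>.\<close>

lemma interrupted_iff:
  assumes e: "e \<in> A" "\<not> geo e" and f: "f \<in> A" "hw f" and neq: "f \<noteq> e"
  shows "interrupted_by M (E e) (E f) \<longleftrightarrow> dh e < dh f"
proof -
  let ?x = "\<lambda>k. (RS ^^ k) (Lab White e)"
  have he: "hw e" using e by (simp add: hw_def)
  define k where "k = hit_time M (E e) (E f)"
  have k_def': "k = (LEAST k. ?x k \<in> E f)"
    unfolding k_def hit_time_def ccw_E[OF e] ..
  obtain k0 where "?x k0 = Lab White f" using reach[OF e(1) he f] by blast
  then have "?x k0 \<in> E f" by (simp add: edge_of_def)
  then have k: "?x k \<in> E f" unfolding k_def' by (rule LeastI)
  have least: "k \<le> j" if "?x j \<in> E f" for j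
    unfolding k_def' using that by (rule Least_le)
  have "pot (?x k) = int (dh f) - int (c f)"
  proof (cases rule: E_cases[OF f])
    case 1
    \<comment> \<open>The two halves of \<open>f\<close> have different potentials, so it matters
      which one is hit first. The black half comes exactly two steps after the white one and cannot
      be first.\<close>
    have "?x k \<noteq> Lab Black f"
    proof
      assume xk: "?x k = Lab Black f"
      have "k \<noteq> 0" using xk by (intro notI) simp
      moreover have "k \<noteq> 1" using xk RS_nongeo(1)[OF e] by (intro notI) simp
      ultimately obtain i where i: "k = Suc (Suc i)" by (metis One_nat_def not0_implies_Suc)
      then have "RS (RS (?x i)) = RS (RS (Lab White f))"
        using xk RS_RS_nongeo[OF f(1) 1(1)] by simp
      then have "?x i = Lab White f" using injD[OF inj_RS] by blast
      then have "k \<le> i" using least[of i] by (simp add: edge_of_def)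
      with i show False by simp
    qed
    with k 1(2) have "?x k = Lab White f" by simp
    then show ?thesis by simp
  next
    case 2
    from k have "?x k = Lab White f \<or> ?x k = Lab White (q f)" unfolding 2(2) by simp
    then show ?thesis by (elim disjE) simp_all
  qed
  moreover have "pot (?x k) = pot (?x 0) + int (b + 1) *
     (int (arc_dist M Black (E e) (E f)) - int (arc_dist M White (E e) (E f)))"
    using pot_RS_pow[of "Lab White e" k] e(1) he
    unfolding arc_dist_def ccw_E[OF e] k_def[symmetric] by simp
  ultimately have main: "int (dh f) - int (c f) = int (dh e) - int (c e) + int (b + 1) *
     (int (arc_dist M Black (E e) (E f)) - int (arc_dist M White (E e) (E f)))" by simp
  define K where "K = int (arc_dist M Black (E e) (E f)) - int (arc_dist M White (E e) (E f))"
  have cne: "c e \<noteq> c f" using E_label_eq[OF e f] neq by blast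
  have ce: "c e \<le> b" "c f \<le> b" using c_le e f by auto
  have "interrupted_by M (E e) (E f) \<longleftrightarrow> 0 < K \<or> K = 0 \<and> c e < c f"
    unfolding interrupted_by_def elabel_E[OF e(1) he] elabel_E[OF f] K_def by linarith
  also have "\<dots> \<longleftrightarrow> dh e < dh f"
  proof -
    define X where "X = int (b + 1) * K"
    have m: "int (dh f) = int (dh e) - int (c e) + int (c f) + X"
      using main unfolding K_def X_def by linarith
    consider "0 < K" | "K = 0" | "K < 0" by linarith
    then show ?thesis
    proof cases
      case 1
      then have "int (b + 1) * 1 \<le> X" unfolding X_def by (intro mult_left_mono) auto
      then have "dh e < dh f" using m ce by simp
      with 1 show ?thesis by simp
    next
      case 2
      then have "X = 0" by (simp add: X_def)
      with 2 m cne show ?thesis by linarith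
    next
      case 3
      then have "X \<le> int (b + 1) * (-1)" unfolding X_def by (intro mult_left_mono) auto
      then have "\<not> dh e < dh f" using m ce by simp
      with 3 show ?thesis by simp
    qed
  qed
  finally show ?thesis .
qed

section \<open>The next labelled edge along the contour\<close>

definition silent :: "'a mdart \<Rightarrow> 'a mdart \<Rightarrow> bool" where
  "silent x y \<longleftrightarrow> (\<exists>m. (RS ^^ m) x = y \<and> (\<forall>j<m. \<forall>s e. (RS ^^ j) x \<noteq> Lab s e))"

lemma silent_refl: "silent x x"
  unfolding silent_def by (intro exI[of _ 0]) simp

lemma silent_trans:
  assumes "silent x y" "silent y z"
  shows "silent x z"
proof -
  obtain m where m: "(RS ^^ m) x = y" "\<And>j s e. j < m \<Longrightarrow> (RS ^^ j) x \<noteq> Lab s e"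
    using assms(1) by (auto simp: silent_def)
  obtain m' where m': "(RS ^^ m') y = z" "\<And>j s e. j < m' \<Longrightarrow> (RS ^^ j) y \<noteq> Lab s e"
    using assms(2) by (auto simp: silent_def)
  have *: "(RS ^^ (i + m)) x = (RS ^^ i) y" for i
    using m(1) by (simp add: funpow_add)
  have "(RS ^^ j) x \<noteq> Lab s e" if "j < m' + m" for j s e
  proof (cases "j < m")
    case False
    then have "j - m < m'" using that by linarith
    with False show ?thesis using m'(2)[of "j - m" s e] *[of "j - m"] by simp
  qed (use m(2) in simp)
  then show ?thesis unfolding silent_def using *[of m'] m'(1) by metis
qed

lemma silent_pd:
  assumes e: "e \<in> A"
  shows "silent (pd e) (nd (p e))"
proof (cases "c e = 0")
  case True
  then have n: "e \<in> N" using e by (simp add: N_iff)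
  show ?thesis
    unfolding silent_def pd_N[OF n] using RS_ArcRev_White[OF n] by (intro exI[of _ 1]) simp
qed (simp add: pd_pos[OF e] silent_refl)

lemma silent_walk:
  assumes "e \<in> A" "\<And>i. 1 \<le> i \<Longrightarrow> i < Suc J \<Longrightarrow> \<not> hw ((p ^^ i) e)"
  shows "silent (pd e) (nd ((p ^^ Suc J) e))"
  using assms(2)
proof (induction J)
  case 0
  then show ?case using silent_pd[OF assms(1)] by simp
next
  case (Suc J)
  have A: "(p ^^ Suc J) e \<in> A" using assms(1) p_pow_A by blast
  have "silent (pd e) (nd ((p ^^ Suc J) e))" using Suc by simp
  moreover have "nd ((p ^^ Suc J) e) = pd ((p ^^ Suc J) e)"
    using Suc.prems[of "Suc J"] nd_eq[OF A] by simp
  ultimately show ?case using silent_trans silent_pd[OF A] by simp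
qed

text \<open>After going around the black loop, the contour walks backwards along white faces and
  sees only arcs until the first arrow with a white half. That \<open>(p ^^ J) e\<close> differs
  from \<open>e\<close> makes the edge met there a new one.\<close>

lemma next_labelled_iff:
  assumes e: "e \<in> A" "\<not> geo e" and J: "1 \<le> J" "hw ((p ^^ J) e)"
    and no: "\<And>i. 1 \<le> i \<Longrightarrow> i < J \<Longrightarrow> \<not> hw ((p ^^ i) e)" and neq: "(p ^^ J) e \<noteq> e"
  shows "next_labelled M (E e) z \<longleftrightarrow> z = E ((p ^^ J) e)"
proof -
  define f where "f = (p ^^ J) e"
  have f: "f \<in> A" "hw f" using e(1) J(2) by (simp_all add: f_def)
  let ?x = "\<lambda>k. (RS ^^ k) (Lab White e)"
  have he: "hw e" using e by (simp add: hw_def)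
  obtain J' where J': "J = Suc J'" using J(1) by (cases J) auto
  have "silent (pd e) (nd f)"
    using silent_walk[OF e(1), of J'] no unfolding f_def J' by blast
  then obtain m where m: "(RS ^^ m) (pd e) = nd f" "\<And>j s g. j < m \<Longrightarrow> (RS ^^ j) (pd e) \<noteq> Lab s g"
    by (auto simp: silent_def)
  \<comment> \<open>The white half, the black loop and the black half of \<open>e\<close> come
    first; hence the offset 3 for the walk starting at \<open>pd e\<close>.\<close>
  have x1: "?x 1 = Arc Black (base Black e)" using RS_nongeo(1)[OF e] by simp
  have x2: "?x 2 = Lab Black e" using RS_RS_nongeo[OF e] by (simp add: eval_nat_numeral)
  have x3: "?x (j + 3) = (RS ^^ j) (pd e)" for j
  proof -
    have "?x 3 = pd e" using RS_RS_nongeo[OF e] RS_nongeo(2)[OF e] by (simp add: eval_nat_numeral)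
    then show ?thesis by (simp add: funpow_add)
  qed
  have hit: "?x (m + 3) = Lab White f" using x3 m(1) f by (simp add: nd_eq)
  have before: "?x j \<notin> E g" if "j < m + 3" "g \<in> A" "hw g" "E g \<noteq> E e" for j g
  proof -
    have "j = 0 \<or> j = 1 \<or> j = 2 \<or> (\<exists>i. j = i + 3 \<and> i < m)"
      using that(1) by presburger
    then consider "j = 0" | "j = 1" | "j = 2" | i where "j = i + 3" "i < m" by blast
    then show ?thesis
    proof cases
      case 1
      then show ?thesis
        using E_disjoint[OF that(2,3) e(1) he, of "Lab White e"] that(4) by (auto simp: edge_of_def)
    next
      case 2
      then show ?thesis using x1 Lab_in_E[OF that(2,3)] by auto
    next
      case 3
      then show ?thesis
        using x2 E_disjoint[OF that(2,3) e(1) he, of "Lab Black e"] that(4) E_nongeo[OF e] by auto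
    next
      case 4
      then show ?thesis using x3 m(2) Lab_in_E[OF that(2,3)] by metis
    qed
  qed
  have Ef: "E f \<noteq> E e" using E_eq_nongeo[OF e] neq f_def by blast
  show ?thesis
    unfolding f_def[symmetric]
  proof
    assume "z = E f"
    then show "next_labelled M (E e) z"
      unfolding next_labelled_def ccw_E[OF e]
    proof (intro conjI exI allI impI ballI)
      show "?x (m + 3) \<in> z" unfolding hit \<open>z = E f\<close> by simp
      show "?x j \<notin> u" if "j < m + 3" "u \<in> labelled_edges M" "u \<noteq> E e" for j u
        using before[OF that(1)] that(2,3) unfolding labelled_M by blast
    qed (use \<open>z = E f\<close> E_labelled[OF f] Ef in simp_all)
  next
    assume nl: "next_labelled M (E e) z"
    then have "z \<in> labelled_edges M" by (simp add: next_labelled_def)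
    then obtain g where g: "z = E g" "g \<in> A" "hw g" unfolding labelled_M by blast
    from nl obtain k where "E g \<noteq> E e" "?x k \<in> E g"
      and k: "\<forall>j<k. \<forall>u\<in>labelled_edges M. u \<noteq> E e \<longrightarrow> ?x j \<notin> u"
      unfolding next_labelled_def ccw_E[OF e] g(1) by (elim conjE exE)
    note z = g this(1,2)
    have "\<not> k < m + 3" using before[of k g] z by blast
    moreover have "\<not> m + 3 < k"
    proof
      assume "m + 3 < k"
      then have "?x (m + 3) \<notin> E f" using k E_labelled[OF f] Ef by blast
      then show False unfolding hit by simp
    qed
    ultimately have "?x k = Lab White f" using hit by (metis nat_neq_iff)
    then show "z = E f"
      using E_disjoint[OF z(2,3) f, of "?x k"] z(1,5) by simp
  qed
qed

text \<open>The arrows passed on the way carry no half, hence are geodesic, and each lowers the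
  distance by one.\<close>

lemma dh_walk:
  assumes "e \<in> A" "1 \<le> J" "\<And>i. 1 \<le> i \<Longrightarrow> i < J \<Longrightarrow> \<not> hw ((p ^^ i) e)"
  shows "dh ((p ^^ J) e) + J = dt e + 1"
  using assms(2,3)
proof (induction J rule: dec_induct)
  case (step i)
  then have "geo ((p ^^ i) e)" by (auto simp: hw_def)
  with step show ?case by (simp add: geo_def)
qed simp

lemma nongeo_index:
  assumes e: "e \<in> A" "\<not> geo e" and k: "1 \<le> k" "k \<le> b"
  shows "geo ((L ^^ k) e)"
proof (rule ccontr)
  assume "\<not> geo ((L ^^ k) e)"
  moreover have "(L ^^ k) e \<in> face_of G e"
    unfolding in_face[OF e(1)] using k by (intro exI[of _ k]) simp
  ultimately have "(L ^^ k) e = (L ^^ 0) e" using ng_unique[OF e(1)] ng_self[OF e] by simp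
  then have "k = 0" using c_L_pow_inj[OF e(1), of k 0] k by simp
  with k show False by simp
qed

lemma dh_index:
  assumes e: "e \<in> A" "\<not> geo e"
  shows "k \<le> b \<Longrightarrow> dh ((L ^^ k) e) = dh e + k"
proof (induction k)
  case (Suc k)
  then have "geo ((L ^^ Suc k) e)" using nongeo_index[OF e, of "Suc k"] by simp
  with Suc show ?case by (simp add: geo_def)
qed simp

text \<open>By \<open>p_L\<close>, a step back along the white face is also a step back along the
  black face as long as the vertex reached is two-valent. At the four-valent vertex of index
  \<open>j\<close> the walk switches to the other incoming arrow.\<close>

lemma face_walk:
  assumes e: "e \<in> A" "\<not> geo e" and j: "j \<le> b"
    and no: "\<And>k. j < k \<Longrightarrow> k \<le> b \<Longrightarrow> q ((L ^^ k) e) = (L ^^ k) e"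
  shows "(p ^^ (b + 1 - j)) e = q ((L ^^ j) e)"
    and "\<And>i. 1 \<le> i \<Longrightarrow> i < b + 1 - j \<Longrightarrow> \<not> hw ((p ^^ i) e)"
proof -
  have walk: "i \<le> b - j \<Longrightarrow> (p ^^ i) e = (L ^^ (b + 1 - i)) e" for i
  proof (induction i)
    case 0
    then show ?case using L_period[OF e(1)] by simp
  next
    case (Suc i)
    then have "(p ^^ Suc i) e = p ((L ^^ Suc (b - i)) e)" by (simp add: Suc_diff_le)
    also have "\<dots> = q ((L ^^ (b - i)) e)" by simp
    also have "\<dots> = (L ^^ (b - i)) e" using Suc.prems by (intro no) auto
    finally show ?case by simp
  qed
  have "(p ^^ Suc (b - j)) e = p ((L ^^ Suc j) e)"
    using walk[of "b - j"] j by (simp add: Suc_diff_le)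
  also have "\<dots> = q ((L ^^ j) e)" by simp
  finally show "(p ^^ (b + 1 - j)) e = q ((L ^^ j) e)" using j by (simp add: Suc_diff_le)
  fix i assume i: "1 \<le> i" "i < b + 1 - j"
  have "(p ^^ i) e = (L ^^ (b + 1 - i)) e" using walk i by simp
  moreover have "q ((L ^^ (b + 1 - i)) e) = (L ^^ (b + 1 - i)) e" using i by (intro no) auto
  moreover have "geo ((L ^^ (b + 1 - i)) e)" using i by (intro nongeo_index[OF e]) auto
  ultimately show "\<not> hw ((p ^^ i) e)" by (simp add: hw_def double_def)
qed

lemma bubble_index:
  assumes e: "e \<in> A" and j: "j \<le> b" "q ((L ^^ j) e) \<noteq> (L ^^ j) e"
  shows "bubble G (face_of G e) \<longleftrightarrow> (\<forall>k\<le>b. q ((L ^^ k) e) \<noteq> (L ^^ k) e \<longrightarrow> k = j)"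
proof -
  let ?F = "{f \<in> face_of G e. q f \<noteq> f}"
  have F: "f \<in> ?F \<longleftrightarrow> (\<exists>k\<le>b. f = (L ^^ k) e \<and> q f \<noteq> f)" for f
    unfolding mem_Collect_eq in_face[OF e] by (auto simp: less_Suc_eq_le)
  have jF: "(L ^^ j) e \<in> ?F" unfolding F using j by blast
  have "card ?F = 1 \<longleftrightarrow> ?F = {(L ^^ j) e}"
  proof
    assume "card ?F = 1"
    then obtain x where x: "?F = {x}" by (auto simp: card_1_singleton_iff)
    have "(L ^^ j) e = x" using jF unfolding x by (rule singletonD)
    then show "?F = {(L ^^ j) e}" using x by (simp only:)
  qed simp
  also have "\<dots> \<longleftrightarrow> (\<forall>k\<le>b. q ((L ^^ k) e) \<noteq> (L ^^ k) e \<longrightarrow> k = j)"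
  proof
    assume eq: "?F = {(L ^^ j) e}"
    show "\<forall>k\<le>b. q ((L ^^ k) e) \<noteq> (L ^^ k) e \<longrightarrow> k = j"
    proof (intro allI impI)
      fix k assume k: "k \<le> b" "q ((L ^^ k) e) \<noteq> (L ^^ k) e"
      then have "(L ^^ k) e \<in> ?F" unfolding F by blast
      then have "(L ^^ k) e = (L ^^ j) e" unfolding eq by simp
      then show "k = j" using c_L_pow_inj[OF e, of k j] k(1) j(1) by simp
    qed
  next
    assume "\<forall>k\<le>b. q ((L ^^ k) e) \<noteq> (L ^^ k) e \<longrightarrow> k = j"
    then have "f = (L ^^ j) e" if "f \<in> ?F" for f using that unfolding F by blast
    with jF show "?F = {(L ^^ j) e}" by blast
  qed
  finally show ?thesis unfolding bubble_iff[OF e] .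
qed

text \<open>The contour runs through the indices downwards, so the largest four-valent index is the
  first one met.\<close>

lemma last_four:
  assumes "\<exists>j. 1 \<le> j \<and> j \<le> b \<and> q ((L ^^ j) e) \<noteq> (L ^^ j) e"
  obtains j where "1 \<le> j" "j \<le> b" "q ((L ^^ j) e) \<noteq> (L ^^ j) e"
    "\<And>k. j < k \<Longrightarrow> k \<le> b \<Longrightarrow> q ((L ^^ k) e) = (L ^^ k) e"
proof -
  let ?J = "{j. 1 \<le> j \<and> j \<le> b \<and> q ((L ^^ j) e) \<noteq> (L ^^ j) e}"
  have fin: "finite ?J" by (rule finite_subset[of _ "{..b}"]) auto
  have "Max ?J \<in> ?J" using assms fin by (intro Max_in) auto
  moreover have "q ((L ^^ k) e) = (L ^^ k) e" if "Max ?J < k" "k \<le> b" for k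
    using Max_ge[OF fin, of k] that by fastforce
  ultimately show ?thesis using that[of "Max ?J"] by blast
qed

text \<open>The arrow \<open>(L ^^ j) e\<close> is geodesic with a four-valent head, so its partner
  is either non-geodesic or also geodesic; in both cases the partner carries a white half.\<close>

lemma next_at_four:
  assumes e: "e \<in> A" "\<not> geo e" and j: "1 \<le> j" "j \<le> b" "q ((L ^^ j) e) \<noteq> (L ^^ j) e"
    and no: "\<And>k. j < k \<Longrightarrow> k \<le> b \<Longrightarrow> q ((L ^^ k) e) = (L ^^ k) e"
  shows "next_labelled M (E e) z \<longleftrightarrow> z = E (q ((L ^^ j) e))"
    and "hw (q ((L ^^ j) e))" and "q ((L ^^ j) e) \<noteq> e" and "dh (q ((L ^^ j) e)) = dh e + j"
proof -
  let ?f = "q ((L ^^ j) e)"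
  have g: "(L ^^ j) e \<in> A" "geo ((L ^^ j) e)" using e nongeo_index[OF e j(1,2)] by simp_all
  show h: "hw ?f" using g j(3) double_q[OF g(1)] by (auto simp: hw_def double_def)
  show dh: "dh ?f = dh e + j" using dh_index[OF e j(2)] by simp
  show neq: "?f \<noteq> e"
  proof
    assume "?f = e"
    then have "dh ?f = dh e" by (rule arg_cong)
    with dh j(1) show False by linarith
  qed
  note fw = face_walk[OF e j(2) no]
  have "next_labelled M (E e) z \<longleftrightarrow> z = E ((p ^^ (b + 1 - j)) e)"
    by (rule next_labelled_iff[OF e]) (use fw j h neq in auto)
  then show "next_labelled M (E e) z \<longleftrightarrow> z = E ?f" by (simp only: fw(1))
qed

section \<open>The two conditions on a black polygon\<close>

lemma p_period: "\<exists>m>0. (p ^^ m) e = e"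
proof -
  have "permutation R"
  proof -
    have "R = r \<circ> t" by (auto simp: R_eq)
    then show ?thesis
      using permutes_compose[OF t_permutes r_permutes] finite_D permutation_permutes by metis
  qed
  from orbit_card_funpow(2,4)[OF this, of e] obtain m where m: "0 < m" "(R ^^ m) e = e" by blast
  have "(p ^^ m) ((R ^^ m) x) = x" for m x
    by (induction m arbitrary: x) (simp_all add: funpow_swap1)
  from this[of m e] m show ?thesis by auto
qed

lemma interrupted_next_iff:
  assumes e: "e \<in> A" "\<not> geo e" "c e \<noteq> 0"
  shows "(\<exists>z. next_labelled M (E e) z \<and> interrupted_by M (E e) z) \<longleftrightarrow> \<not> bubble G (face_of G e)"
proof -
  have qe: "q e \<noteq> e" "geo (q e)" using nongeo_head[OF e(1,2)] e(3) colour_x0 by auto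
  have bub: "bubble G (face_of G e) \<longleftrightarrow> \<not> (\<exists>j. 1 \<le> j \<and> j \<le> b \<and> q ((L ^^ j) e) \<noteq> (L ^^ j) e)"
    using bubble_index[OF e(1), of 0] qe(1) by (auto simp: Suc_le_eq)
  show ?thesis
  proof (cases "bubble G (face_of G e)")
    case False
    then obtain j where j: "1 \<le> j" "j \<le> b" "q ((L ^^ j) e) \<noteq> (L ^^ j) e"
      "\<And>k. j < k \<Longrightarrow> k \<le> b \<Longrightarrow> q ((L ^^ k) e) = (L ^^ k) e"
      using bub last_four[of e] by metis
    note n = next_at_four[OF e(1,2) j]
    have "q ((L ^^ j) e) \<in> A" using e(1) by simp
    from interrupted_iff[OF e(1,2) this n(2,3)] n(1,4) j(1) False show ?thesis by auto
  next
    case True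
    then have no: "q ((L ^^ k) e) = (L ^^ k) e" if "0 < k" "k \<le> b" for k
      using bub that by (auto simp: Suc_le_eq)
    note fw = face_walk[OF e(1,2) le0 no, simplified]
    \<comment> \<open>By periodicity of \<open>p\<close> the walk returns to \<open>e\<close>, which
      carries a half, so a first arrow with a half exists.\<close>
    have "hw e" using e by (simp add: hw_def)
    then have "\<exists>J. 1 \<le> J \<and> hw ((p ^^ J) e)" using p_period[of e] by (metis One_nat_def Suc_leI)
    define J where "J = (LEAST J. 1 \<le> J \<and> hw ((p ^^ J) e))"
    have J: "1 \<le> J" "hw ((p ^^ J) e)"
      using LeastI_ex[OF \<open>\<exists>J. 1 \<le> J \<and> hw ((p ^^ J) e)\<close>] unfolding J_def by auto
    have least: "\<not> hw ((p ^^ i) e)" if "1 \<le> i" "i < J" for i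
      using not_less_Least[of i "\<lambda>J. 1 \<le> J \<and> hw ((p ^^ J) e)"] that unfolding J_def by blast
    have "\<not> hw (q e)" using qe(2) e(1,2) q_q by (simp add: hw_def double_def)
    \<comment> \<open>The walk covers the whole bubble and reaches \<open>q e\<close> after
      \<open>b + 1\<close> steps. Since \<open>q e\<close> carries no half, the walk goes on, and
      \<open>dh_walk\<close> then makes its end strictly nearer to \<open>x0\<close> than the head
      of \<open>e\<close>.\<close>
    then have "b + 1 < J" using J fw by (metis Suc_eq_plus1 Suc_leI le_neq_implies_less not_less_eq_eq
          linorder_neqE_nat One_nat_def Suc_le_lessD less_Suc_eq funpow.simps(2) comp_apply)
    moreover have "dh ((p ^^ J) e) + J = dh e + b + 1"
      using dh_walk[OF e(1) J(1) least] dt_nongeo[OF e(1,2)] by simp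
    ultimately have lt: "dh ((p ^^ J) e) < dh e" by linarith
    then have neq: "(p ^^ J) e \<noteq> e" by auto
    have A: "(p ^^ J) e \<in> A" using e(1) by simp
    from next_labelled_iff[OF e(1,2) J least neq] interrupted_iff[OF e(1,2) A J(2) neq] lt True
    show ?thesis by auto
  qed
qed

text \<open>A two-valent vertex has one outgoing arrow, so shortest paths from \<open>x0\<close>
  cannot leave the face before index \<open>j\<close>.\<close>

lemma geodesic_on_bubble:
  assumes e: "e \<in> A" "head G e = x0"
    and no: "\<And>k. k < j \<Longrightarrow> q ((L ^^ k) e) = (L ^^ k) e"
  shows "x \<in> A \<Longrightarrow> geo x \<Longrightarrow> dh x = Suc m \<Longrightarrow> Suc m \<le> j \<Longrightarrow> x = (L ^^ Suc m) e"
proof (induction m arbitrary: x)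
  case 0
  have "tail G x = head G e"
    using 0 dist_0_iff[OF tail_in[OF \<open>x \<in> A\<close>]] e(2) by (simp add: geo_def)
  moreover have "R e = L e" using no[of 0] 0 R_q[of e] by simp
  ultimately show ?case using out_of_head[OF e(1) 0(1)] by auto
next
  case (Suc m)
  have "dt x = Suc m" using Suc.prems by (simp add: geo_def)
  then have "tail G x \<noteq> x0" using dist_0_iff[OF x0_vertex] by auto
  then obtain y where y: "y \<in> A" "head G y = tail G x" "geo y"
    using ex_geo_into[OF tail_in[OF \<open>x \<in> A\<close>]] by blast
  have "y = (L ^^ Suc m) e" using Suc.IH[OF y(1,3)] y(2) \<open>dt x = Suc m\<close> Suc.prems by simp
  moreover have "q y = y" using no[of "Suc m"] calculation Suc.prems by simp
  then have "R y = L y" using R_q[of y] by simp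
  ultimately show ?case using out_of_head[OF y(1) \<open>x \<in> A\<close>] y(2) by auto
qed

text \<open>The head of \<open>e\<close> is \<open>x0\<close>, so index and distance agree along the
  face up to index \<open>b\<close>. The next labelled edge is that of \<open>f\<close>, at the last
  four-valent index \<open>j\<close>, and its weight selects the alternative.\<close>

lemma label_0_iff:
  assumes e: "e \<in> A" "\<not> geo e" "c e = 0"
  shows "((\<exists>z. next_labelled M (E e) z \<and> eweight M z = 0) \<or>
         (\<exists>y. next_labelled M (E e) y \<and> eweight M y = 1 \<and>
            (\<exists>z\<in>labelled_edges M. z \<noteq> y \<and> elabel M z \<noteq> 0 \<and> \<not> interrupted_by M y z)))
     \<longleftrightarrow> \<not> bubble G (face_of G e)"
proof -
  have x0: "head G e = x0" using c_0_nongeo_iff[OF e(1,2)] e(3) by simp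
  then have dh0: "dh e = 0" using dist_0_iff[OF x0_vertex] by simp
  have qe: "q e = e" using q_eq_of_c_0[OF e(1,3)] .
  have "\<exists>j. 1 \<le> j \<and> j \<le> b \<and> q ((L ^^ j) e) \<noteq> (L ^^ j) e"
  proof -
    obtain i where i: "i < b + 1" "q ((L ^^ i) e) \<noteq> (L ^^ i) e"
      using face_has_four[OF e(1)] unfolding Bex_def in_face[OF e(1)] by blast
    then have "i \<noteq> 0" using qe by (intro notI) simp
    with i show ?thesis by (intro exI[of _ i]) auto
  qed
  then obtain j where j: "1 \<le> j" "j \<le> b" "q ((L ^^ j) e) \<noteq> (L ^^ j) e"
    "\<And>k. j < k \<Longrightarrow> k \<le> b \<Longrightarrow> q ((L ^^ k) e) = (L ^^ k) e"
    using last_four[of e] by metis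
  define f where "f = q ((L ^^ j) e)"
  have g: "(L ^^ j) e \<in> A" "geo ((L ^^ j) e)" using e nongeo_index[OF e(1,2) j(1,2)] by simp_all
  have fA: "f \<in> A" using g by (simp add: f_def)
  note n = next_at_four[OF e(1,2) j, folded f_def]
  have dhf: "dh f = j" using n(4) dh0 by simp
  note bub = bubble_index[OF e(1) j(2,3)]
  show ?thesis
  proof (cases "bubble G (face_of G e)")
    case False
    have "\<exists>z\<in>labelled_edges M. z \<noteq> E f \<and> elabel M z \<noteq> 0 \<and> \<not> interrupted_by M (E f) z" if ngf: "\<not> geo f"
    proof -
      \<comment> \<open>The witness is an edge at another four-valent vertex of the face, of smaller
        index and therefore nearer to \<open>x0\<close> than the head of \<open>f\<close>.\<close>
      from False bub obtain k where k: "k \<le> b" "q ((L ^^ k) e) \<noteq> (L ^^ k) e" "k \<noteq> j" by blast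
      then have "k \<noteq> 0" using qe by (intro notI) simp
      have "k < j" using j(4)[of k] k by (meson linorder_neqE_nat)
      define f' where "f' = q ((L ^^ k) e)"
      have g': "(L ^^ k) e \<in> A" "geo ((L ^^ k) e)"
        using e nongeo_index[OF e(1,2) _ k(1)] \<open>k \<noteq> 0\<close> by simp_all
      have f'A: "f' \<in> A" using g' by (simp add: f'_def)
      have h: "hw f'" unfolding f'_def using g' k(2) double_q[OF g'(1)] by (auto simp: hw_def double_def)
      have dhf': "dh f' = k" using dh_index[OF e(1,2) k(1)] dh0 by (simp add: f'_def)
      then have "f' \<noteq> f" using dhf \<open>k < j\<close> by auto
      have "c f' \<noteq> 0" using q_eq_of_c_0[OF g'(1)] k(2) by (auto simp: f'_def)
      moreover have "E f' \<noteq> E f" using E_eq_nongeo[OF fA ngf] \<open>f' \<noteq> f\<close> by blast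
      moreover have "\<not> interrupted_by M (E f) (E f')"
        using interrupted_iff[OF fA ngf f'A h \<open>f' \<noteq> f\<close>] dhf dhf' \<open>k < j\<close> by simp
      ultimately show ?thesis using elabel_E[OF f'A h] E_labelled[OF f'A h] by (intro bexI[of _ "E f'"]) simp_all
    qed
    then show ?thesis using False n(1) eweight_E[OF fA n(2)] by (cases "geo f") auto
  next
    case True
    have no: "q ((L ^^ k) e) = (L ^^ k) e" if "k < j" for k
      using True bub that j(2) by (metis less_imp_le_nat less_irrefl_nat order_trans)
    have on: "x = (L ^^ dh x) e" if x: "x \<in> A" "geo x" "dh x \<le> j" for x
      using geodesic_on_bubble[OF e(1) x0 no, where j = j and x = x and m = "dt x"] x by (simp add: geo_def)
    have ngf: "\<not> geo f"
    proof
      assume "geo f"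
      then have "f = (L ^^ j) e" using on[OF fA] dhf by simp
      then show False using j(3) by (simp add: f_def)
    qed
    have "interrupted_by M (E f) z" if z: "z \<in> labelled_edges M" "z \<noteq> E f" "elabel M z \<noteq> 0" for z
    proof -
      obtain y where y: "y \<in> A" "hw y" "z = E y" using z(1) by (auto simp: labelled_M)
      have cy: "c y \<noteq> 0" using z(3) y elabel_E by simp
      have neq: "y \<noteq> f" using y z(2) by auto
      have "j < dh y"
      proof (rule ccontr)
        assume "\<not> j < dh y"
        then have le: "dh y \<le> j" by simp
        \<comment> \<open>One of \<open>y\<close> and \<open>q y\<close> is a geodesic arrow into
          the four-valent vertex of \<open>z\<close>. At distance at most \<open>j\<close>,
          \<open>on\<close> puts it on the bubble, so it is the arrow of index \<open>j\<close> and
          its partner is \<open>f\<close>; both possibilities for \<open>y\<close> then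
          fail.\<close>
        have "\<exists>x. x \<in> A \<and> geo x \<and> q x \<noteq> x \<and> head G x = head G y"
        proof (cases "geo y")
          case True
          then show ?thesis using y by (auto simp: hw_def double_def)
        next
          case False
          then have "q y \<noteq> y" "geo (q y)" using nongeo_head[OF y(1)] cy colour_x0 by auto
          then show ?thesis using y(1) q_q[OF y(1)] by (intro exI[of _ "q y"]) auto
        qed
        then obtain x where x: "x \<in> A" "geo x" "q x \<noteq> x" "head G x = head G y" by blast
        have xL: "x = (L ^^ dh x) e" using on[OF x(1,2)] x(4) le by simp
        have "dh x \<le> j" using le x(4) by simp
        moreover have "\<not> dh x < j" using no[of "dh x"] xL x(3) by metis
        ultimately have "dh x = j" by simp
        then have "x = (L ^^ j) e" using xL by simp
        then have "q x = f" by (simp add: f_def)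
        then have "y = x" using into_head[OF x(1) y(1)] x(4) neq by metis
        then have "double y" using y(2) x(2) by (simp add: hw_def)
        then show False using ngf \<open>y = x\<close> \<open>q x = f\<close> by (simp add: double_def)
      qed
      then show ?thesis unfolding y(3) using interrupted_iff[OF fA ngf y(1,2) neq] dhf by simp
    qed
    then show ?thesis using True n(1) eweight_E[OF fA n(2)] ngf by auto
  qed
qed

text \<open>Every black face contains the closing arrow \<open>base Black e\<close> of any of its
  arrows \<open>e\<close>, so the closing arrows index the black faces as well as the black
  polygons.\<close>

lemma pruned_iff: "pruned G \<longleftrightarrow> (\<forall>n\<in>N. \<not> bubble G (face_of G (ng n)))"
proof -
  have "black_faces G = face_of G ` A"
    by (auto simp: black_faces_def faces_def white_faces_def arrow_iff)
  also have "\<dots> = (\<lambda>n. face_of G (ng n)) ` N"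
  proof
    show "face_of G ` A \<subseteq> (\<lambda>n. face_of G (ng n)) ` N"
    proof
      fix F assume "F \<in> face_of G ` A"
      then obtain e where e: "e \<in> A" "F = face_of G e" by blast
      have "face_of G (ng e) = F" using face_face[OF e(1) ng_face[OF e(1)]] e(2) by simp
      then have "F = face_of G (ng (base Black e))" using ng_base_Black(1)[OF e(1)] by simp
      then show "F \<in> (\<lambda>n. face_of G (ng n)) ` N" using base_N[OF e(1), where s=Black] by blast
    qed
    show "(\<lambda>n. face_of G (ng n)) ` N \<subseteq> face_of G ` A" using N_A ng_A by blast
  qed
  finally show ?thesis by (simp add: pruned_def)
qed

lemma pruned_iff_mobile:
  "pruned G \<longleftrightarrow>
    (\<forall>P\<in>black_polygons M.
       (elabel M (polygon_edge M P) \<noteq> 0 \<and>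
        (\<exists>z. next_labelled M (polygon_edge M P) z \<and> interrupted_by M (polygon_edge M P) z)) \<or>
       (elabel M (polygon_edge M P) = 0 \<and>
        ((\<exists>z. next_labelled M (polygon_edge M P) z \<and> eweight M z = 0) \<or>
         (\<exists>y. next_labelled M (polygon_edge M P) y \<and> eweight M y = 1 \<and>
            (\<exists>z\<in>labelled_edges M. z \<noteq> y \<and> elabel M z \<noteq> 0 \<and> \<not> interrupted_by M y z)))))"
    (is "_ \<longleftrightarrow> (\<forall>P\<in>_. ?Q (polygon_edge M P))")
proof -
  have "?Q (E (ng n)) \<longleftrightarrow> \<not> bubble G (face_of G (ng n))" if n: "n \<in> N" for n
  proof -
    have e: "ng n \<in> A" "\<not> geo (ng n)" using N_A[OF n] ng_nongeo by auto
    then have h: "hw (ng n)" by (simp add: hw_def)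
    show ?thesis
      using interrupted_next_iff[OF e] label_0_iff[OF e] elabel_E[OF e(1) h] by (cases "c (ng n) = 0") auto
  qed
  then show ?thesis
    unfolding pruned_iff black_polygons_def arcs_M
    by (simp add: face_Arc_Black polygon_edge_M)
qed

end

theorem mainTheorem2:
  fixes G :: "'a galaxy" and \<mu> :: "nat list" and d :: nat and x0 :: "'a set"
    and M :: "'a mdart mobile"
  assumes "d \<ge> 2"
    and "is_partition \<mu> d"
    and "hurwitz_galaxy \<mu> d G"
    and "x0 \<in> vertices G" and "colour G x0 = 0"
    and "M = Phi (length \<mu> + d - 2) G x0"
  shows "pruned G \<longleftrightarrow>
    (\<forall>P\<in>black_polygons M.
       (elabel M (polygon_edge M P) \<noteq> 0 \<and>
        (\<exists>z. next_labelled M (polygon_edge M P) z \<and> interrupted_by M (polygon_edge M P) z)) \<or>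
       (elabel M (polygon_edge M P) = 0 \<and>
        ((\<exists>z. next_labelled M (polygon_edge M P) z \<and> eweight M z = 0) \<or>
         (\<exists>y. next_labelled M (polygon_edge M P) y \<and> eweight M y = 1 \<and>
            (\<exists>z\<in>labelled_edges M. z \<noteq> y \<and> elabel M z \<noteq> 0 \<and> \<not> interrupted_by M y z)))))"
proof -
  interpret marked_galaxy G \<mu> d x0 "length \<mu> + d - 2"
    using assms by unfold_locales auto
  show ?thesis
    unfolding assms(6) by (rule pruned_iff_mobile)
qed

end
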